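(* Let $G$ be a nontrivial finite group. Then, for any integer $n>0$, there exists a $G$-graded ring $R$ such that $R_1$ has UGN and $\mathrm{gn}(R)=n$.
   Context: Rings are unital; "module" means right module. A ring $S$ has unbounded generating number (UGN) if, for every positive integer $n$, there is no $S$-module epimorphism $S^n\to S^{n+1}$. If $S$ does not have UGN, its generating number $\mathrm{gn}(S)$ is the smallest positive integer $n$ for which there is an $S$-module epimorphism $S^n\to S^{n+1}$; if $S$ has UGN, $\mathrm{gn}(S):=\aleph_0$. A ring $R$ is $G$-graded if there are additive subgroups $R_g$ ($g\in G$) with $R=\bigoplus_{g\in G}R_g$ as additive groups and $R_gR_h\subseteq R_{gh}$ for all $g,h\in G$. $R_1$ is the base ring, the component of the identity of $G$. *)

theory Defs
  imports "HOL-Algebra.AbelCoset" "HOL-Library.Extended_Nat"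
begin

text \<open>The library's modules are over commutative rings only, so right modules over an
  arbitrary unital ring are introduced here.  As in the library's own module record, the
  fields inherited from rings other than the additive structure are unused.\<close>

record ('a, 'b) rmodule = "'b ring" +
  rsmult :: "'b \<Rightarrow> 'a \<Rightarrow> 'b" (infixl "\<triangleleft>\<index>" 70)

locale right_module = S: ring S + M: abelian_group M
  for S :: "('a, 'm) ring_scheme" and M :: "('a, 'b, 'c) rmodule_scheme" +
  assumes rsmult_closed:
      "\<lbrakk>x \<in> carrier M; r \<in> carrier S\<rbrakk> \<Longrightarrow> x \<triangleleft>\<^bsub>M\<^esub> r \<in> carrier M"
    and rsmult_l_distr:
      "\<lbrakk>x \<in> carrier M; y \<in> carrier M; r \<in> carrier S\<rbrakk>
        \<Longrightarrow> (x \<oplus>\<^bsub>M\<^esub> y) \<triangleleft>\<^bsub>M\<^esub> r = x \<triangleleft>\<^bsub>M\<^esub> r \<oplus>\<^bsub>M\<^esub> y \<triangleleft>\<^bsub>M\<^esub> r"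
    and rsmult_r_distr:
      "\<lbrakk>x \<in> carrier M; r \<in> carrier S; s \<in> carrier S\<rbrakk>
        \<Longrightarrow> x \<triangleleft>\<^bsub>M\<^esub> (r \<oplus>\<^bsub>S\<^esub> s) = x \<triangleleft>\<^bsub>M\<^esub> r \<oplus>\<^bsub>M\<^esub> x \<triangleleft>\<^bsub>M\<^esub> s"
    and rsmult_assoc:
      "\<lbrakk>x \<in> carrier M; r \<in> carrier S; s \<in> carrier S\<rbrakk>
        \<Longrightarrow> x \<triangleleft>\<^bsub>M\<^esub> (r \<otimes>\<^bsub>S\<^esub> s) = (x \<triangleleft>\<^bsub>M\<^esub> r) \<triangleleft>\<^bsub>M\<^esub> s"
    and rsmult_one: "x \<in> carrier M \<Longrightarrow> x \<triangleleft>\<^bsub>M\<^esub> \<one>\<^bsub>S\<^esub> = x"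

definition rmodule_hom ::
    "('a, 'm) ring_scheme \<Rightarrow> ('a, 'b, 'c) rmodule_scheme \<Rightarrow> ('a, 'd, 'e) rmodule_scheme \<Rightarrow> ('b \<Rightarrow> 'd) set"
  where "rmodule_hom S M N =
    {f \<in> carrier M \<rightarrow> carrier N.
       (\<forall>x\<in>carrier M. \<forall>y\<in>carrier M. f (x \<oplus>\<^bsub>M\<^esub> y) = f x \<oplus>\<^bsub>N\<^esub> f y) \<and>
       (\<forall>x\<in>carrier M. \<forall>r\<in>carrier S. f (x \<triangleleft>\<^bsub>M\<^esub> r) = f x \<triangleleft>\<^bsub>N\<^esub> r)}"

definition rmodule_epi ::
    "('a, 'm) ring_scheme \<Rightarrow> ('a, 'b, 'c) rmodule_scheme \<Rightarrow> ('a, 'd, 'e) rmodule_scheme \<Rightarrow> ('b \<Rightarrow> 'd) set"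
  where "rmodule_epi S M N = {f \<in> rmodule_hom S M N. f ` carrier M = carrier N}"

text \<open>The right module \<open>S\<^sup>n\<close>, with vectors represented as extensional functions on \<open>{..<n}\<close>.\<close>

definition free_rmodule :: "('a, 'm) ring_scheme \<Rightarrow> nat \<Rightarrow> ('a, nat \<Rightarrow> 'a) rmodule"
  where "free_rmodule S n =
    \<lparr>carrier = {..<n} \<rightarrow>\<^sub>E carrier S, monoid.mult = undefined, one = undefined,
     ring.zero = (\<lambda>i\<in>{..<n}. \<zero>\<^bsub>S\<^esub>),
     add = (\<lambda>x y. \<lambda>i\<in>{..<n}. x i \<oplus>\<^bsub>S\<^esub> y i),
     rsmult = (\<lambda>x r. \<lambda>i\<in>{..<n}. x i \<otimes>\<^bsub>S\<^esub> r)\<rparr>"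

lemma right_module_free_rmodule:
  assumes "ring S"
  shows "right_module S (free_rmodule S n)"
proof -
  interpret S: ring S by fact
  let ?F = "free_rmodule S n"
  have mem: "x \<in> carrier ?F \<longleftrightarrow> (\<forall>i<n. x i \<in> carrier S) \<and> x \<in> extensional {..<n}" for x
    by (auto simp: free_rmodule_def PiE_def Pi_def)
  have ops: "i < n \<Longrightarrow> (x \<oplus>\<^bsub>?F\<^esub> y) i = x i \<oplus>\<^bsub>S\<^esub> y i" "i < n \<Longrightarrow> \<zero>\<^bsub>?F\<^esub> i = \<zero>\<^bsub>S\<^esub>"
    "i < n \<Longrightarrow> (x \<triangleleft>\<^bsub>?F\<^esub> r) i = x i \<otimes>\<^bsub>S\<^esub> r"
    "x \<oplus>\<^bsub>?F\<^esub> y \<in> extensional {..<n}" "\<zero>\<^bsub>?F\<^esub> \<in> extensional {..<n}"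
    "x \<triangleleft>\<^bsub>?F\<^esub> r \<in> extensional {..<n}" for x y r i
    by (simp_all add: free_rmodule_def)
  have eqI: "x = y"
    if "x \<in> extensional {..<n}" "y \<in> extensional {..<n}" "\<And>i. i < n \<Longrightarrow> x i = y i"
    for x y :: "nat \<Rightarrow> 'a"
    using that by (intro extensionalityI[of _ "{..<n}"]) simp_all
  have "abelian_group ?F"
  proof (rule abelian_groupI)
    fix x assume x: "x \<in> carrier ?F"
    let ?y = "\<lambda>i\<in>{..<n}. \<ominus>\<^bsub>S\<^esub> x i"
    have "?y \<in> carrier ?F"
      using x by (simp add: mem)
    moreover have "?y \<oplus>\<^bsub>?F\<^esub> x = \<zero>\<^bsub>?F\<^esub>"
      using x by (intro eqI) (simp_all add: mem ops S.l_neg)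
    ultimately show "\<exists>y\<in>carrier ?F. y \<oplus>\<^bsub>?F\<^esub> x = \<zero>\<^bsub>?F\<^esub>" by blast
  next
    fix x y z assume "x \<in> carrier ?F" "y \<in> carrier ?F" "z \<in> carrier ?F"
    then show "x \<oplus>\<^bsub>?F\<^esub> y \<oplus>\<^bsub>?F\<^esub> z = x \<oplus>\<^bsub>?F\<^esub> (y \<oplus>\<^bsub>?F\<^esub> z)"
      by (intro eqI) (simp_all add: mem ops S.a_assoc)
  next
    fix x y assume "x \<in> carrier ?F" "y \<in> carrier ?F"
    then show "x \<oplus>\<^bsub>?F\<^esub> y \<in> carrier ?F" by (simp add: mem ops)
  next
    fix x y assume "x \<in> carrier ?F" "y \<in> carrier ?F"
    then show "x \<oplus>\<^bsub>?F\<^esub> y = y \<oplus>\<^bsub>?F\<^esub> x"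
      by (intro eqI) (simp_all add: mem ops S.a_comm)
  next
    show "\<zero>\<^bsub>?F\<^esub> \<in> carrier ?F" by (simp add: mem ops)
  next
    fix x assume "x \<in> carrier ?F"
    then show "\<zero>\<^bsub>?F\<^esub> \<oplus>\<^bsub>?F\<^esub> x = x" by (intro eqI) (simp_all add: mem ops)
  qed
  then show ?thesis
  proof (intro right_module.intro right_module_axioms.intro assms)
    fix x r assume "x \<in> carrier ?F" "r \<in> carrier S"
    then show "x \<triangleleft>\<^bsub>?F\<^esub> r \<in> carrier ?F" by (simp add: mem ops)
  next
    fix x y r assume "x \<in> carrier ?F" "y \<in> carrier ?F" "r \<in> carrier S"
    then show "(x \<oplus>\<^bsub>?F\<^esub> y) \<triangleleft>\<^bsub>?F\<^esub> r = x \<triangleleft>\<^bsub>?F\<^esub> r \<oplus>\<^bsub>?F\<^esub> y \<triangleleft>\<^bsub>?F\<^esub> r"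
      by (intro eqI) (simp_all add: mem ops S.l_distr)
  next
    fix x r s assume "x \<in> carrier ?F" "r \<in> carrier S" "s \<in> carrier S"
    then show "x \<triangleleft>\<^bsub>?F\<^esub> (r \<oplus>\<^bsub>S\<^esub> s) = x \<triangleleft>\<^bsub>?F\<^esub> r \<oplus>\<^bsub>?F\<^esub> x \<triangleleft>\<^bsub>?F\<^esub> s"
      by (intro eqI) (simp_all add: mem ops S.r_distr)
  next
    fix x r s assume "x \<in> carrier ?F" "r \<in> carrier S" "s \<in> carrier S"
    then show "x \<triangleleft>\<^bsub>?F\<^esub> (r \<otimes>\<^bsub>S\<^esub> s) = (x \<triangleleft>\<^bsub>?F\<^esub> r) \<triangleleft>\<^bsub>?F\<^esub> s"
      by (intro eqI) (simp_all add: mem ops S.m_assoc)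
  next
    fix x assume "x \<in> carrier ?F"
    then show "x \<triangleleft>\<^bsub>?F\<^esub> \<one>\<^bsub>S\<^esub> = x" by (intro eqI) (simp_all add: mem ops)
  qed
qed

definition has_UGN :: "('a, 'm) ring_scheme \<Rightarrow> bool"
  where "has_UGN S \<longleftrightarrow>
    (\<forall>n>0. \<not> (\<exists>f. f \<in> rmodule_epi S (free_rmodule S n) (free_rmodule S (n + 1))))"

text \<open>The value \<open>\<aleph>\<^sub>0\<close> of the generating number is rendered as \<open>\<infinity>\<close>.\<close>

definition gn :: "('a, 'm) ring_scheme \<Rightarrow> enat"
  where "gn S = (if has_UGN S then \<infinity> else
    enat (LEAST n. n > 0 \<and>
      (\<exists>f. f \<in> rmodule_epi S (free_rmodule S n) (free_rmodule S (n + 1)))))"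

text \<open>The direct sum decomposition is expressed by unique finitely supported families of
  homogeneous components; the finite sum is taken over the support because \<^const>\<open>finsum\<close> is
  only meaningful on finite sets and \<open>G\<close> may be infinite.\<close>

locale graded_ring = G: group G + R: ring R
  for G :: "('g, 'm) monoid_scheme" and R :: "('r, 'k) ring_scheme" and A :: "'g \<Rightarrow> 'r set" +
  assumes component_additive_subgroup: "g \<in> carrier G \<Longrightarrow> additive_subgroup (A g) R"
    and direct_sum: "x \<in> carrier R \<Longrightarrow>
      \<exists>!c. c \<in> (\<Pi>\<^sub>E g\<in>carrier G. A g) \<and>
           finite {g \<in> carrier G. c g \<noteq> \<zero>\<^bsub>R\<^esub>} \<and>
           x = (\<Oplus>\<^bsub>R\<^esub>g\<in>{g \<in> carrier G. c g \<noteq> \<zero>\<^bsub>R\<^esub>}. c g)"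
    and component_mult: "\<lbrakk>g \<in> carrier G; h \<in> carrier G; a \<in> A g; b \<in> A h\<rbrakk>
      \<Longrightarrow> a \<otimes>\<^bsub>R\<^esub> b \<in> A (g \<otimes>\<^bsub>G\<^esub> h)"

definition base_ring ::
    "('g, 'm) monoid_scheme \<Rightarrow> ('r, 'k) ring_scheme \<Rightarrow> ('g \<Rightarrow> 'r set) \<Rightarrow> ('r, 'k) ring_scheme"
  where "base_ring G R A = R\<lparr>carrier := A \<one>\<^bsub>G\<^esub>\<rparr>"

end

theory Submission
  imports Defs "HOL-Library.Poly_Mapping" "HOL-Library.Z2" "HOL-Algebra.Subrings"
begin

text \<open>
  Let \<open>R\<close> be the algebra over the field with two elements that is generated by elements
  \<open>a i j\<close>, \<open>b j k\<close> (indexed by natural numbers) and \<open>e\<close> subject to the relations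
  \<open>(\<Sum>j<n. a i j * b j k) = (if i = k then 1 else 0)\<close> and \<open>e * e = e\<close>.  The relations can be read
  as rewrite rules that replace \<open>a i 0 * b 0 k\<close> and \<open>e * e\<close>; the only overlap
  is \<open>e * e * e\<close>, which is harmless, so the words without such a factor form a basis of \<open>R\<close>.

  \<^item> The matrices \<open>(a i j)\<close> and \<open>(b j k)\<close> give an epimorphism from \<open>R\<^sup>n\<close> to \<open>R\<^sup>n\<^sup>+\<^sup>1\<close>
    (\<open>epi_at\<close>).

  \<^item> If \<open>g\<close> is an element of \<open>G\<close> other than the identity, then \<open>R\<close> is graded by its Peirce
    decomposition with respect to \<open>e\<close>: the corners \<open>e R e\<close> and \<open>(1 - e) R (1 - e)\<close> have degree 1,
    and \<open>e R (1 - e)\<close> and \<open>(1 - e) R e\<close> have degrees \<open>g\<close> and the inverse of \<open>g\<close>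
    (\<open>peirce_grading\<close>).  The base ring is \<open>e R e \<times> (1 - e) R (1 - e)\<close>.  Now \<open>e R e\<close> has the
    normal words that begin and end with \<open>e\<close> as a basis, and two of them are multiplied by
    merging the adjacent letters \<open>e\<close>.  Hence the coefficient of the word \<open>e\<close> is a homomorphism
    from \<open>e R e\<close> to a field, and the base ring has unbounded generating number
    (\<open>base_ring_has_UGN\<close>).

  \<^item> It remains to see that there is no epimorphism from \<open>R\<^sup>m\<close> to \<open>R\<^sup>m\<^sup>+\<^sup>1\<close> for \<open>m < n\<close>, that is,
    no product \<open>C D = 1\<close> with \<open>C\<close> of size \<open>(m + 1) \<times> m\<close>.  Sending \<open>e\<close> to 0, one may calculate in the
    subring \<open>R\<^sub>0\<close> that is generated by the \<open>a i j\<close> and \<open>b j k\<close>.  This ring satisfies the weak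
    algorithm of Cohn for fewer than \<open>n\<close> elements (\<open>weak_algorithm\<close>): if \<open>x 1, ..., x m\<close> are
    nonzero and right linearly dependent with \<open>m < n\<close>, then the degree of some \<open>x i\<close> can be lowered
    by subtracting a right linear combination of the others.  Column operations of this kind
    reduce the first row of \<open>C\<close> until its nonzero entries are independent.  Then the
    corresponding rows of \<open>D\<close> vanish outside the first column, and a smaller counterexample results
    (\<open>no_right_inverse\<close>).

  The weak algorithm is a statement on leading terms, hence on the associated graded ring \<open>H\<close>, in
  which the relations are \<open>(\<Sum>j<n. a i j * b j k) = 0\<close>.  There it says that homogeneous elements
  \<open>x 1, ..., x m\<close> with \<open>m < n\<close>, none of which is a right linear combination of the others, are right
  independent (\<open>graded_independent\<close>).  Given a relation \<open>(\<Sum>i. x i * y i) = 0\<close>, one cancels the last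
  letters of the \<open>y i\<close>.  For most letters this gives a relation of lower degree at once; for the
  letters \<open>b 0 k, ..., b (n - 1) k\<close> one obtains instead elements \<open>h j\<close> of the right ideal
  generated by the \<open>x i\<close> which have the form \<open>h j = (\<Sum>l. c l * a l j)\<close>.  Since there are fewer
  than \<open>n\<close> elements \<open>x i\<close>, some nontrivial linear combination of the \<open>h j\<close> involves the \<open>x i\<close> only with
  coefficients of positive degree.  This forces the elements \<open>c l\<close> into the right ideal as well, and
  again relations of lower degree result.
\<close>

section \<open>Linear extension over the field with two elements\<close>

text \<open>A vector space with basis \<open>'w\<close> over the field with two elements consists of the finitely
  supported functions from \<open>'w\<close> to \<^typ>\<open>bit\<close>.\<close>

abbreviation basis :: "'w \<Rightarrow> 'w \<Rightarrow>\<^sub>0 bit"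
  where "basis w \<equiv> Poly_Mapping.single w 1"

abbreviation lookup :: "('w \<Rightarrow>\<^sub>0 bit) \<Rightarrow> 'w \<Rightarrow> bit"
  where "lookup \<equiv> Poly_Mapping.lookup"

abbreviation keys :: "('w \<Rightarrow>\<^sub>0 bit) \<Rightarrow> 'w set"
  where "keys \<equiv> Poly_Mapping.keys"

text \<open>The linear extension of a map that is defined on the basis.\<close>

definition lin :: "('w \<Rightarrow> 'v \<Rightarrow>\<^sub>0 bit) \<Rightarrow> ('w \<Rightarrow>\<^sub>0 bit) \<Rightarrow> 'v \<Rightarrow>\<^sub>0 bit"
  where "lin f v = (\<Sum>w\<in>keys v. f w)"

text \<open>All basis vectors that occur in an element have a given property.\<close>

definition supported :: "('w \<Rightarrow> bool) \<Rightarrow> ('w \<Rightarrow>\<^sub>0 bit) \<Rightarrow> bool"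
  where "supported P v \<longleftrightarrow> (\<forall>w\<in>keys v. P w)"

lemma double_eq_0 [simp]: "v + v = (0 :: 'w \<Rightarrow>\<^sub>0 bit)"
  by (rule poly_mapping_eqI) (simp add: lookup_add)

lemma add_eq_0_iff_F2: "u + v = 0 \<longleftrightarrow> u = (v :: 'w \<Rightarrow>\<^sub>0 bit)"
  using double_eq_0 by (metis add_right_cancel)

lemma minus_eq_plus_F2: "u - v = u + (v :: 'w \<Rightarrow>\<^sub>0 bit)"
  by (simp add: diff_eq_eq add.assoc)

lemma lin_eq_sum:
  assumes "finite K" "keys v \<subseteq> K"
  shows "lin f v = (\<Sum>w\<in>K. if lookup v w = 0 then 0 else f w)"
proof -
  have "(\<Sum>w\<in>K. if lookup v w = 0 then 0 else f w)
      = (\<Sum>w\<in>keys v. if lookup v w = 0 then 0 else f w)"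
    using assms by (intro sum.mono_neutral_right) (auto simp: in_keys_iff)
  also have "\<dots> = lin f v"
    unfolding lin_def by (intro sum.cong) (auto simp: in_keys_iff)
  finally show ?thesis ..
qed

lemma additive_lin: "Modules.additive (lin f)"
proof
  fix u v :: "'a \<Rightarrow>\<^sub>0 bit"
  let ?K = "keys u \<union> keys v"
  have "lin f (u + v) = (\<Sum>w\<in>?K. if lookup (u + v) w = 0 then 0 else f w)"
    using keys_add[of u v] by (intro lin_eq_sum) auto
  also have "\<dots> = (\<Sum>w\<in>?K. (if lookup u w = 0 then 0 else f w) + (if lookup v w = 0 then 0 else f w))"
    by (intro sum.cong) (auto simp: lookup_add)
  also have "\<dots> = lin f u + lin f v"
    by (simp add: sum.distrib lin_eq_sum[of ?K])
  finally show "lin f (u + v) = lin f u + lin f v" .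
qed

lemmas lin_add = additive.add[OF additive_lin]
lemmas lin_0 [simp] = additive.zero[OF additive_lin]

lemma lin_basis [simp]: "lin f (basis w) = f w"
  by (simp add: lin_def)

lemma sum_basis_keys: "(\<Sum>w\<in>keys v. basis w) = v"
proof (rule poly_mapping_eqI)
  fix w
  show "lookup (\<Sum>w\<in>keys v. basis w) w = lookup v w"
    by (simp add: lookup_sum lookup_single when_def in_keys_iff sum.delta)
qed

text \<open>Additive maps are determined by their values on the words that occur.\<close>

lemma additive_eqI:
  assumes "Modules.additive F" "Modules.additive G" "\<And>w. w \<in> keys v \<Longrightarrow> F (basis w) = G (basis w)"
  shows "F v = G v"
proof -
  have "F (\<Sum>w\<in>keys v. basis w) = G (\<Sum>w\<in>keys v. basis w)"
    unfolding additive.sum[OF assms(1)] additive.sum[OF assms(2)]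
    by (intro sum.cong refl assms(3))
  then show ?thesis by (simp only: sum_basis_keys)
qed

lemma additive_compose:
  assumes "Modules.additive F" "Modules.additive G"
  shows "Modules.additive (\<lambda>v. F (G v))"
  by standard (simp add: additive.add[OF assms(1)] additive.add[OF assms(2)])

lemma additive_plus:
  assumes "Modules.additive F" "Modules.additive G"
  shows "Modules.additive (\<lambda>v. F v + G v)"
  by standard (simp add: additive.add[OF assms(1)] additive.add[OF assms(2)])

lemma additive_zero: "Modules.additive (\<lambda>v. 0)"
  by standard simp

lemma additive_id: "Modules.additive (\<lambda>v. v)"
  by standard simp

lemma additive_if:
  "Modules.additive F \<Longrightarrow> Modules.additive G \<Longrightarrow> Modules.additive (\<lambda>v. if c then F v else G v)"
  by (cases c) simp_all

lemma additive_sum_fun: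
  assumes "\<And>i. i \<in> I \<Longrightarrow> Modules.additive (F i)"
  shows "Modules.additive (\<lambda>v. \<Sum>i\<in>I. F i v)"
  by standard (simp add: additive.add[OF assms] sum.distrib cong: sum.cong)

lemma additive_lookup: "Modules.additive (\<lambda>v. lookup v w)"
  by standard (simp only: lookup_add)

lemma supported_0 [simp]: "supported P 0"
  by (simp add: supported_def)

lemma supported_basis [simp]: "supported P (basis w) \<longleftrightarrow> P w"
  by (simp add: supported_def)

lemma supported_add: "supported P u \<Longrightarrow> supported P v \<Longrightarrow> supported P (u + v)"
  using keys_add[of u v] by (auto simp: supported_def)

lemma supported_diff: "supported P u \<Longrightarrow> supported P v \<Longrightarrow> supported P (u - v)"
  by (simp add: minus_eq_plus_F2 supported_add)

lemma supported_sum: "(\<And>i. i \<in> I \<Longrightarrow> supported P (f i)) \<Longrightarrow> supported P (\<Sum>i\<in>I. f i)"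
  by (induction I rule: infinite_finite_induct) (auto intro: supported_add)

lemma supported_lin:
  "supported Q v \<Longrightarrow> (\<And>w. Q w \<Longrightarrow> supported P (f w)) \<Longrightarrow> supported P (lin f v)"
  unfolding lin_def by (intro supported_sum) (auto simp: supported_def)

lemma supported_mono: "supported P v \<Longrightarrow> (\<And>w. P w \<Longrightarrow> Q w) \<Longrightarrow> supported Q v"
  by (auto simp: supported_def)

lemma supported_FalseD: "supported (\<lambda>w. False) v \<Longrightarrow> v = 0"
  by (rule poly_mapping_eqI) (auto simp: supported_def in_keys_iff)

lemma supported_conj: "supported P v \<Longrightarrow> supported Q v \<Longrightarrow> supported (\<lambda>w. P w \<and> Q w) v"
  by (auto simp: supported_def)

section \<open>The ring by generators and relations, and its associated graded ring\<close>

text \<open>The generators \<open>a i j\<close>, \<open>b j k\<close> and \<open>e\<close>.  Words in the generators are lists in reversed order: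
  the head of the list is the last letter of the word, so that multiplication by a letter from the
  right is \<^const>\<open>Cons\<close>.\<close>

datatype gen = Ga nat nat | Gb nat nat | Ge

text \<open>Appending the letter \<open>x\<close> to the word \<open>w\<close> creates the left-hand side of a rewrite rule, namely
  a factor \<open>a i 0 * b 0 k\<close> or \<open>e * e\<close>.\<close>

fun reducible :: "gen \<Rightarrow> gen list \<Rightarrow> bool" where
  "reducible (Gb j k) (Ga i l # w) \<longleftrightarrow> j = 0 \<and> l = 0"
| "reducible Ge (Ge # w) \<longleftrightarrow> True"
| "reducible x w \<longleftrightarrow> False"

text \<open>The words without such factors; they are a basis of the ring.\<close>

primrec normal :: "gen list \<Rightarrow> bool" where
  "normal [] \<longleftrightarrow> True"
| "normal (x # w) \<longleftrightarrow> \<not> reducible x w \<and> normal w"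

text \<open>The flag \<open>q\<close> distinguishes two rings.  If it is true, the relations for \<open>n > 0\<close> are
  \<open>(\<Sum>j<n. a i j * b j k) = (if i = k then 1 else 0)\<close> and \<open>e * e = e\<close>; if it is false, the right-hand
  sides are replaced by 0, which gives the associated graded ring.\<close>

context
  fixes n :: nat and q :: bool
begin

text \<open>Multiplication of a word by a letter from the right, in normal form if the word is normal.
  Signs do not matter in characteristic 2.\<close>

fun act :: "gen \<Rightarrow> gen list \<Rightarrow> gen list \<Rightarrow>\<^sub>0 bit" where
  "act (Gb j k) (Ga i l # w) =
    (if j = 0 \<and> l = 0
     then (if q \<and> i = k then basis w else 0) + (\<Sum>m\<in>{1..<n}. basis (Gb m k # Ga i m # w))
     else basis (Gb j k # Ga i l # w))"
| "act Ge (Ge # w) = (if q then basis (Ge # w) else 0)"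
| "act x w = basis (x # w)"

text \<open>Multiplication of an element by a word from the right.\<close>

primrec word_act :: "gen list \<Rightarrow> (gen list \<Rightarrow>\<^sub>0 bit) \<Rightarrow> gen list \<Rightarrow>\<^sub>0 bit" where
  "word_act [] u = u"
| "word_act (x # w) u = lin (act x) (word_act w u)"

text \<open>The product.  It is associative on the whole space with all words as its basis, but the empty
  word is a left unit only for elements supported on normal words.\<close>

definition mul :: "(gen list \<Rightarrow>\<^sub>0 bit) \<Rightarrow> (gen list \<Rightarrow>\<^sub>0 bit) \<Rightarrow> gen list \<Rightarrow>\<^sub>0 bit"
  where "mul u v = lin (\<lambda>w. word_act w u) v"

lemma act_irreducible: "\<not> reducible x w \<Longrightarrow> act x w = basis (x # w)"
  by (cases "(x, w)" rule: reducible.cases) auto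

lemma reducibleE:
  assumes "reducible x w"
  obtains k i t where "x = Gb 0 k" "w = Ga i 0 # t" | t where "x = Ge" "w = Ge # t"
  using assms by (cases "(x, w)" rule: reducible.cases) auto

lemma additive_word_act: "Modules.additive (word_act w)"
proof (induction w)
  case Nil
  show ?case by standard simp
next
  case (Cons x w)
  then show ?case
    using additive_compose[OF additive_lin] by simp
qed

lemma mul_basis_right [simp]: "mul u (basis w) = word_act w u"
  by (simp add: mul_def)

lemma mul_add_right: "mul u (v + v') = mul u v + mul u v'"
  by (simp add: mul_def lin_add)

lemma mul_add_left: "mul (u + u') v = mul u v + mul u' v"
  by (simp add: mul_def lin_def additive.add[OF additive_word_act] sum.distrib)

lemma additive_mul_right: "Modules.additive (mul u)"
  by standard (rule mul_add_right)

lemma additive_mul_left: "Modules.additive (\<lambda>u. mul u v)"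
  by standard (rule mul_add_left)

lemma mul_0_right [simp]: "mul u 0 = 0"
  by (rule additive.zero[OF additive_mul_right])

lemma mul_0_left [simp]: "mul 0 v = 0"
  by (rule additive.zero[OF additive_mul_left])

lemmas mul_sum_right = additive.sum[OF additive_mul_right]
lemmas mul_sum_left = additive.sum[OF additive_mul_left]

text \<open>The operators attached to the generators satisfy the defining relations; this is what
  makes the multiplication associative.\<close>

lemma mul_act: "mul u (act x w) = lin (act x) (word_act w u)"
proof (cases "reducible x w")
  case False
  then show ?thesis by (simp add: act_irreducible)
next
  case True
  then show ?thesis
  proof (cases rule: reducibleE)
    case (1 k i t)
    define p where "p = word_act t u"
    have unit_term: "mul u (if c then basis t else 0) = (if c then p else 0)" for c
      by (simp add: p_def)
    have "mul u (act x w) = (if q \<and> i = k then p else 0)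
        + (\<Sum>m\<in>{1..<n}. lin (act (Gb m k)) (lin (act (Ga i m)) p))"
      by (simp add: 1 mul_add_right mul_sum_right p_def[symmetric] unit_term)
    also have "\<dots> = lin (act (Gb 0 k)) (lin (act (Ga i 0)) p)"
      (is "?F p = ?G p")
    proof (rule additive_eqI[where F = ?F and G = ?G])
      show "Modules.additive ?F"
        by (intro additive_plus additive_sum_fun additive_compose[OF additive_lin additive_lin]
            additive_if additive_id additive_zero)
      show "Modules.additive ?G"
        by (intro additive_compose[OF additive_lin additive_lin])
    qed (auto intro!: sum.cong)
    finally show ?thesis by (simp add: 1 p_def)
  next
    case (2 t)
    have idem: "(if q then lin (act Ge) p else 0) = lin (act Ge) (lin (act Ge) p)"
      (is "?F p = ?G p") for p
    proof (rule additive_eqI[where F = ?F and G = ?G])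
      show "Modules.additive ?F"
        by (intro additive_if additive_lin additive_zero)
      show "Modules.additive ?G"
        by (intro additive_compose[OF additive_lin additive_lin])
      show "?F (basis w) = ?G (basis w)" for w
      proof (cases "reducible Ge w")
        case True
        then show ?thesis by (elim reducibleE) auto
      next
        case False
        show ?thesis unfolding lin_basis act_irreducible[OF False] by simp
      qed
    qed
    have "mul u (if c then basis (Ge # t) else 0) = (if c then lin (act Ge) (word_act t u) else 0)" for c
      by simp
    then show ?thesis
      unfolding 2 word_act.simps act.simps idem[symmetric] .
  qed
qed

lemma mul_lin_act: "mul u (lin (act x) v) = lin (act x) (mul u v)"
proof (rule additive_eqI[of "\<lambda>v. mul u (lin (act x) v)"])
  show "Modules.additive (\<lambda>v. mul u (lin (act x) v))"
    by (intro additive_compose[OF additive_mul_right additive_lin])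
  show "Modules.additive (\<lambda>v. lin (act x) (mul u v))"
    by (intro additive_compose[OF additive_lin additive_mul_right])
qed (simp add: mul_act)

lemma mul_word_act: "mul u (word_act w v) = word_act w (mul u v)"
  by (induction w) (simp_all add: mul_lin_act)

lemma mul_assoc: "mul (mul u v) w = mul u (mul v w)"
proof (rule additive_eqI[of "mul (mul u v)"])
  show "Modules.additive (\<lambda>w. mul u (mul v w))"
    by (intro additive_compose[OF additive_mul_right additive_mul_right])
qed (simp_all add: additive_mul_right mul_word_act)

lemma word_act_one: "normal w \<Longrightarrow> word_act w (basis []) = basis w"
  by (induction w) (simp_all add: act_irreducible)

lemma mul_one_left:
  assumes "supported normal v"
  shows "mul (basis []) v = v"
proof (rule additive_eqI[of "mul (basis [])"])
  show "mul (basis []) (basis w) = basis w" if "w \<in> keys v" for w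
    using assms that by (simp add: word_act_one supported_def)
qed (auto intro: additive_mul_right additive_id)

lemma supported_mul:
  assumes "supported P u" "supported Q v" "\<And>w. P w \<Longrightarrow> R w"
    "\<And>x t w. Q (x # t) \<Longrightarrow> Q t"
    "\<And>x t w. Q (x # t) \<Longrightarrow> R w \<Longrightarrow> supported R (act x w)"
  shows "supported R (mul u v)"
  unfolding mul_def
proof (rule supported_lin[OF assms(2)])
  show "supported R (word_act w u)" if "Q w" for w
    using that
  proof (induction w)
    case Nil
    show ?case using assms(1,3) by (auto intro: supported_mono)
  next
    case (Cons x w)
    then show ?case
      using assms(4,5) by (auto intro!: supported_lin[where Q = R])
  qed
qed

lemma supported_act_normal: "normal w \<Longrightarrow> supported normal (act x w)"
proof (cases "reducible x w")
  case True
  assume "normal w"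
  with True show ?thesis
    by (elim reducibleE) (auto intro!: supported_add supported_sum)
qed (simp add: act_irreducible)

lemma supported_normal_mul: "supported normal u \<Longrightarrow> supported normal v \<Longrightarrow> supported normal (mul u v)"
  by (erule supported_mul[where Q = normal]) (auto intro: supported_act_normal)

end

section \<open>Independence in the associated graded ring\<close>

text \<open>The element \<open>quo x v\<close> is the coefficient of \<open>x\<close> when \<open>v\<close> is written as a constant plus a sum of
  elements times their last letters.\<close>

definition quo :: "gen \<Rightarrow> (gen list \<Rightarrow>\<^sub>0 bit) \<Rightarrow> gen list \<Rightarrow>\<^sub>0 bit"
  where "quo x = lin (\<lambda>w. case w of [] \<Rightarrow> 0 | y # t \<Rightarrow> if y = x then basis t else 0)"

text \<open>The map \<open>swap p r\<close> replaces a last letter \<open>a l p\<close> by \<open>a l r\<close> and kills the words which do not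
  end in such a letter.  It commutes with multiplication from the left, up to constant terms, and
  makes it possible to compare the products \<open>c l * a l j\<close> for different \<open>j\<close> without naming the \<open>c l\<close>.\<close>

definition swap :: "nat \<Rightarrow> nat \<Rightarrow> (gen list \<Rightarrow>\<^sub>0 bit) \<Rightarrow> gen list \<Rightarrow>\<^sub>0 bit"
  where "swap p r = lin (\<lambda>w. case w of Ga l s # t \<Rightarrow> if s = p then basis (Ga l r # t) else 0 | _ \<Rightarrow> 0)"

lemma additive_quo: "Modules.additive (quo x)"
  unfolding quo_def by (rule additive_lin)

lemma additive_swap: "Modules.additive (swap p r)"
  unfolding swap_def by (rule additive_lin)

lemmas quo_sum = additive.sum[OF additive_quo]
lemmas quo_0 [simp] = additive.zero[OF additive_quo]
lemmas swap_sum = additive.sum[OF additive_swap]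
lemmas swap_0 [simp] = additive.zero[OF additive_swap]

lemma quo_basis [simp]:
  "quo x (basis []) = 0"
  "quo x (basis (y # t)) = (if y = x then basis t else 0)"
  by (simp_all add: quo_def)

lemma swap_basis [simp]:
  "swap p r (basis []) = 0"
  "swap p r (basis (Ga l s # t)) = (if s = p then basis (Ga l r # t) else 0)"
  "swap p r (basis (Gb j k # t)) = 0"
  "swap p r (basis (Ge # t)) = 0"
  by (simp_all add: swap_def)

lemma lookup_quo: "lookup (quo x v) t = lookup v (x # t)"
proof (rule additive_eqI[where F = "\<lambda>v. lookup (quo x v) t" and G = "\<lambda>v. lookup v (x # t)"])
  show "lookup (quo x (basis w)) t = lookup (basis w) (x # t)" for w
    by (cases w) (auto simp: lookup_single when_def)
qed (auto intro: additive_compose[OF additive_lookup additive_quo] additive_lookup)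

lemma supported_quo: "supported P v \<Longrightarrow> (\<And>t. P (x # t) \<Longrightarrow> Q t) \<Longrightarrow> supported Q (quo x v)"
  by (auto simp: supported_def in_keys_iff lookup_quo)

lemma supported_swap:
  assumes "supported P v" "\<And>l t. P (Ga l p # t) \<Longrightarrow> Q (Ga l r # t)"
  shows "supported Q (swap p r v)"
  unfolding swap_def
  by (rule supported_lin[OF assms(1)]) (auto split: list.split gen.split intro: assms(2))

lemma swap_swap: "swap p r (swap s m v) = (if m = p then swap s r v else 0)"
proof (rule additive_eqI[where F = "\<lambda>v. swap p r (swap s m v)" and G = "\<lambda>v. if m = p then swap s r v else 0"])
  show "Modules.additive (\<lambda>v. if m = p then swap s r v else 0)"
    by (intro additive_if additive_swap additive_zero)
  show "swap p r (swap s m (basis w)) = (if m = p then swap s r (basis w) else 0)" for w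
  proof (cases w)
    case (Cons y t)
    then show ?thesis by (cases y) auto
  qed simp
qed (rule additive_compose[OF additive_swap additive_swap])

lemma eq_0_if_quo_eq_0:
  assumes "lookup v [] = 0" "\<And>x. quo x v = 0"
  shows "v = 0"
proof (rule poly_mapping_eqI)
  fix w
  show "lookup v w = lookup 0 w"
  proof (cases w)
    case (Cons x t)
    then show ?thesis using lookup_quo[of x v t] assms(2) by simp
  qed (simp add: assms)
qed

lemma quo_act_free:
  assumes "x \<noteq> Ge" "\<And>j k. x = Gb j k \<Longrightarrow> j \<ge> n" "n > 0"
  shows "quo x (lin (act n False y) v) = (if y = x then v else 0)"
proof (rule additive_eqI[where F = "\<lambda>v. quo x (lin (act n False y) v)" and G = "\<lambda>v. if y = x then v else 0"])
  show "Modules.additive (\<lambda>v. if y = x then v else 0)"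
    by (intro additive_if additive_id additive_zero)
  show "quo x (lin (act n False y) (basis w)) = (if y = x then basis w else 0)" for w
  proof (cases "reducible y w")
    case False
    then show ?thesis by (simp add: act_irreducible)
  next
    case True
    then show ?thesis
    proof (cases rule: reducibleE)
      case (1 k i t)
      have unequal: "Gb m k \<noteq> x" if "m < n" for m
        using assms(2)[of m k] that by auto
      have "(\<Sum>m\<in>{1..<n}. quo x (basis (Gb m k # Ga i m # t))) = 0"
        using unequal by (intro sum.neutral) auto
      moreover have "(if y = x then basis w else 0) = 0"
        using 1 unequal[of 0] assms(3) by auto
      ultimately show ?thesis using 1 by (simp add: quo_sum)
    next
      case (2 t)
      then show ?thesis using assms(1) by auto
    qed
  qed
qed (rule additive_compose[OF additive_quo additive_lin])

text \<open>In the graded ring, a product ending in \<open>b j k\<close> with \<open>j < n\<close> arises by appending this letter or by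
  rewriting \<open>a i 0 * b 0 k\<close>.  For \<open>j = 0\<close> the second summand removes the reducible words.\<close>

lemma quo_act_Gb:
  assumes "j < n"
  shows "quo (Gb j k) (lin (act n False y) v)
    = (if y = Gb j k then v else 0) + (if y = Gb 0 k then swap 0 j v else 0)"
    (is "?F v = ?G v")
proof (rule additive_eqI[where F = ?F and G = ?G])
  show "Modules.additive ?F"
    by (rule additive_compose[OF additive_quo additive_lin])
  show "Modules.additive ?G"
    by (intro additive_plus additive_if additive_id additive_zero additive_swap)
  show "?F (basis w) = ?G (basis w)" for w
  proof (cases "reducible y w")
    case False
    have "swap 0 j (basis w) = 0" if "y = Gb 0 k"
    proof (cases w)
      case (Cons z t)
      then show ?thesis using False that by (cases z) auto
    qed simp
    then show ?thesis using False by (auto simp: act_irreducible)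
  next
    case True
    then show ?thesis
    proof (cases rule: reducibleE)
      case (1 k' i t)
      have "(\<Sum>m\<in>{1..<n}. quo (Gb j k) (basis (Gb m k' # Ga i m # t)))
          = (\<Sum>m\<in>{1..<n}. if m = j then (if k' = k then basis (Ga i m # t) else 0) else 0)"
        by (intro sum.cong) auto
      also have "\<dots> = (if 1 \<le> j \<and> k' = k then basis (Ga i j # t) else 0)"
        using assms by (auto simp: sum.delta)
      finally show ?thesis using 1 by (cases j) (auto simp: quo_sum)
    next
      case (2 t)
      then show ?thesis by auto
    qed
  qed
qed

lemma swap_act:
  "swap p r (lin (act n False y) v)
    = (case y of Ga l s \<Rightarrow> if s = p then lin (act n False (Ga l r)) v else 0 | _ \<Rightarrow> 0)"
    (is "?F v = ?G v")
proof (rule additive_eqI[where F = ?F and G = ?G])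
  show "Modules.additive ?F"
    by (rule additive_compose[OF additive_swap additive_lin])
  show "Modules.additive ?G"
    by (cases y) (auto intro: additive_if additive_lin additive_zero)
  show "?F (basis w) = ?G (basis w)" for w
  proof (cases "reducible y w")
    case False
    then show ?thesis by (cases y) (auto simp: act_irreducible)
  next
    case True
    then show ?thesis
      by (elim reducibleE) (auto simp: swap_sum)
  qed
qed

text \<open>An additive identity need only be checked on nonempty words for elements without
  constant term.\<close>

lemma additive_eqI_pos:
  assumes "lookup v [] = 0" "Modules.additive F" "Modules.additive G"
    "\<And>y t. F (basis (y # t)) = G (basis (y # t))"
  shows "F v = G v"
proof (rule additive_eqI[OF assms(2,3)])
  fix w assume "w \<in> keys v"
  with assms(1) have "w \<noteq> []" by (auto simp: in_keys_iff)
  then show "F (basis w) = G (basis w)"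
    using assms(4) by (cases w) auto
qed

lemma quo_mul_free:
  assumes "lookup v [] = 0" "x \<noteq> Ge" "\<And>j k. x = Gb j k \<Longrightarrow> j \<ge> n" "n > 0"
  shows "quo x (mul n False u v) = mul n False u (quo x v)"
proof (rule additive_eqI_pos[OF assms(1), where F = "\<lambda>v. quo x (mul n False u v)" and G = "\<lambda>v. mul n False u (quo x v)"])
  show "quo x (mul n False u (basis (y # t))) = mul n False u (quo x (basis (y # t)))" for y t
    using quo_act_free[of x n y, OF assms(2-4)] by simp
qed (rule additive_compose[OF additive_quo additive_mul_right] additive_compose[OF additive_mul_right additive_quo])+

lemma quo_mul_Gb:
  assumes "lookup v [] = 0" "j < n"
  shows "quo (Gb j k) (mul n False u v)
    = mul n False u (quo (Gb j k) v) + swap 0 j (mul n False u (quo (Gb 0 k) v))"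
    (is "?F v = ?G v")
proof (rule additive_eqI_pos[OF assms(1), where F = ?F and G = ?G])
  show "?F (basis (y # t)) = ?G (basis (y # t))" for y t
    using quo_act_Gb[OF assms(2), of k y] by simp
  show "Modules.additive ?G"
    by (intro additive_plus additive_compose[OF additive_mul_right additive_quo]
        additive_compose[OF additive_swap additive_compose[OF additive_mul_right additive_quo]])
qed (rule additive_compose[OF additive_quo additive_mul_right])

lemma swap_mul:
  assumes "lookup v [] = 0"
  shows "swap p r (mul n False u v) = mul n False u (swap p r v)"
proof (rule additive_eqI_pos[OF assms(1), where F = "\<lambda>v. swap p r (mul n False u v)" and G = "\<lambda>v. mul n False u (swap p r v)"])
  show "swap p r (mul n False u (basis (y # t))) = mul n False u (swap p r (basis (y # t)))" for y t
    by (cases y) (simp_all add: swap_act)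
qed (rule additive_compose[OF additive_swap additive_mul_right] additive_compose[OF additive_mul_right additive_swap])+

text \<open>A system of linear equations over the field with two elements that has fewer equations
  than unknowns has a nonzero solution, which is described here by its support.\<close>

lemma F2_kernel:
  fixes c :: "'i \<Rightarrow> nat \<Rightarrow> bit"
  assumes "finite I" "card I < n"
  obtains L where "L \<subseteq> {..<n}" "L \<noteq> {}" "\<And>i. i \<in> I \<Longrightarrow> (\<Sum>j\<in>L. c i j) = 0"
proof -
  define f where "f M = {i \<in> I. (\<Sum>j\<in>M. c i j) = 1}" for M
  have "f ` Pow {..<n} \<subseteq> Pow I" by (auto simp: f_def)
  then have "card (f ` Pow {..<n}) \<le> card (Pow I)"
    using assms by (intro card_mono) auto
  also have "\<dots> < card (Pow {..<n})"
    using assms by (simp add: card_Pow)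
  finally have "\<not> inj_on f (Pow {..<n})" by (rule pigeonhole)
  then obtain M M' where M: "M \<subseteq> {..<n}" "M' \<subseteq> {..<n}" "M \<noteq> M'" "f M = f M'"
    by (auto simp: inj_on_def)
  define L where "L = (M - M') \<union> (M' - M)"
  have fin: "finite M" "finite M'" using M(1,2) by (blast intro: finite_subset)+
  have "(\<Sum>j\<in>L. c i j) = 0" if "i \<in> I" for i
  proof -
    have split_sum: "(\<Sum>j\<in>A. c i j) = (\<Sum>j\<in>A - B. c i j) + (\<Sum>j\<in>A \<inter> B. c i j)" if "finite A" for A B
      using sum.Int_Diff[OF that, of "c i" B] by (simp only: add.commute)
    have "(\<Sum>j\<in>M. c i j) = (\<Sum>j\<in>M'. c i j)"
    proof -
      have bit_eqI: "a = b" if "a = 1 \<longleftrightarrow> b = 1" for a b :: bit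
        using that by (cases a; cases b) simp_all
      have "i \<in> f M \<longleftrightarrow> i \<in> f M'" using M(4) by simp
      then show ?thesis using that unfolding f_def by (intro bit_eqI) blast
    qed
    then have "(\<Sum>j\<in>M - M'. c i j) + (\<Sum>j\<in>M \<inter> M'. c i j) = (\<Sum>j\<in>M' - M. c i j) + (\<Sum>j\<in>M \<inter> M'. c i j)"
      unfolding split_sum[OF fin(1), of M'] split_sum[OF fin(2), of M] by (simp only: Int_commute)
    then have "(\<Sum>j\<in>M - M'. c i j) = (\<Sum>j\<in>M' - M. c i j)"
      by (rule add_right_imp_eq)
    moreover have "(\<Sum>j\<in>L. c i j) = (\<Sum>j\<in>M - M'. c i j) + (\<Sum>j\<in>M' - M. c i j)"
      unfolding L_def using fin by (intro sum.union_disjoint) auto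
    ultimately show ?thesis by (cases "\<Sum>j\<in>M' - M. c i j") auto
  qed
  moreover have "L \<subseteq> {..<n}" "L \<noteq> {}" using M by (auto simp: L_def)
  ultimately show thesis using that by blast
qed

text \<open>The good words are a basis of the subring that is generated by the \<open>a i j\<close> and \<open>b j k\<close>.\<close>

definition good :: "gen list \<Rightarrow> bool"
  where "good w \<longleftrightarrow> normal w \<and> Ge \<notin> set w"

lemma good_tl: "good (x # w) \<Longrightarrow> good w"
  by (simp add: good_def)

lemma good_Ga: "good (Ga l p # t) \<Longrightarrow> good (Ga l r # t)"
  by (simp add: good_def)

text \<open>Here \<open>d i\<close> plays the role of the degree of \<open>x i\<close>, and \<open>D\<close> is the degree of the relation.\<close>

lemma graded_independent:
  fixes x y :: "nat \<Rightarrow> gen list \<Rightarrow>\<^sub>0 bit" and d :: "nat \<Rightarrow> nat"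
  assumes I: "finite I" "card I < n"
    and nodep: "\<And>i z. i \<in> I \<Longrightarrow> (\<And>j. j \<in> I \<Longrightarrow> supported good (z j))
      \<Longrightarrow> (\<And>j. j \<in> I \<Longrightarrow> supported (\<lambda>w. length w + d j = d i) (z j))
      \<Longrightarrow> x i \<noteq> (\<Sum>j\<in>I - {i}. mul n False (x j) (z j))"
    and y: "\<And>i. i \<in> I \<Longrightarrow> supported good (y i)"
      "\<And>i. i \<in> I \<Longrightarrow> supported (\<lambda>w. length w + d i = D) (y i)"
    and rel: "(\<Sum>i\<in>I. mul n False (x i) (y i)) = 0"
    and i: "i \<in> I"
  shows "y i = 0"
  using y rel i
proof (induction D arbitrary: y i rule: less_induct)
  case (less D)
  note y = less.prems(1,2) and rel = less.prems(3)
  \<comment> \<open>A coefficient \<open>y i\<close> with a constant term is itself constant, as it is homogeneous, and then \<open>x i\<close>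
    is a combination of the other elements.\<close>
  have const: "lookup (y i) [] = 0" if i: "i \<in> I" for i
  proof (rule ccontr)
    assume nz: "lookup (y i) [] \<noteq> 0"
    then have "D = d i"
      using y(2)[OF i] by (auto simp: supported_def in_keys_iff)
    then have "lookup (y i) w = lookup (basis []) w" for w
    proof (cases "w = []")
      case True
      then show ?thesis using nz by simp
    next
      case False
      then have "w \<notin> keys (y i)"
        using \<open>D = d i\<close> y(2)[OF i] by (auto simp: supported_def)
      then show ?thesis using False by (simp add: in_keys_iff lookup_single)
    qed
    then have "y i = basis []" by (rule poly_mapping_eqI)
    then have "x i + (\<Sum>j\<in>I - {i}. mul n False (x j) (y j)) = 0"
      using rel i I(1) by (simp add: sum.remove)
    then have "x i = (\<Sum>j\<in>I - {i}. mul n False (x j) (y j))"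
      by (simp only: add_eq_0_iff_F2)
    with nodep[OF i, of y] y show False
      unfolding \<open>D = d i\<close> by blast
  qed
  show "y i = 0"
  proof (cases "D = 0")
    case True
    show ?thesis
    proof (rule poly_mapping_eqI)
      fix w
      show "lookup (y i) w = lookup 0 w"
        using y(2)[OF less.prems(4)] const[OF less.prems(4)] True
        by (cases w) (auto simp: supported_def in_keys_iff)
    qed
  next
    case False
    have IH: "y' i = 0" if "\<And>i. i \<in> I \<Longrightarrow> supported good (y' i)"
      "\<And>i. i \<in> I \<Longrightarrow> supported (\<lambda>w. length w + d i = D - 1) (y' i)"
      "(\<Sum>i\<in>I. mul n False (x i) (y' i)) = 0" "i \<in> I" for y' i
      by (rule less.IH[of "D - 1"]) (use that False in auto)
    have sup_quo: "supported good (quo z (y i))"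
      "supported (\<lambda>w. length w + d i = D - 1) (quo z (y i))" if "i \<in> I" for z i
      by (rule supported_quo[OF y(1)[OF that]], erule good_tl)
        (rule supported_quo[OF y(2)[OF that]], auto)
    have free: "quo z (y i) = 0" if z: "z \<noteq> Ge" "\<And>j k. z = Gb j k \<Longrightarrow> j \<ge> n" and i: "i \<in> I" for z i
    proof (rule IH[OF _ _ _ i])
      have "(\<Sum>i\<in>I. mul n False (x i) (quo z (y i))) = quo z (\<Sum>i\<in>I. mul n False (x i) (y i))"
        unfolding quo_sum using const z I(2) by (intro sum.cong) (auto simp: quo_mul_free)
      then show "(\<Sum>i\<in>I. mul n False (x i) (quo z (y i))) = 0" by (simp add: rel)
    qed (use sup_quo in auto)
    have bound: "quo (Gb j k) (y i) = 0" if j: "j < n" and i: "i \<in> I" for j k i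
    proof -
      define h where "h j = (\<Sum>i\<in>I. mul n False (x i) (quo (Gb j k) (y i)))" for j
      have h: "h j = swap 0 j (h 0)" if "j < n" for j
      proof -
        have "h j + swap 0 j (h 0) = quo (Gb j k) (\<Sum>i\<in>I. mul n False (x i) (y i))"
          unfolding h_def swap_sum quo_sum sum.distrib[symmetric]
          using const that by (intro sum.cong) (auto simp: quo_mul_Gb)
        then show ?thesis by (simp add: rel add_eq_0_iff_F2)
      qed
      \<comment> \<open>A combination of the columns for which all constant terms cancel; it exists since there
        are fewer than \<open>n\<close> elements \<open>x i\<close>.\<close>
      obtain L where L: "L \<subseteq> {..<n}" "L \<noteq> {}"
        "\<And>i. i \<in> I \<Longrightarrow> (\<Sum>j\<in>L. lookup (quo (Gb j k) (y i)) []) = 0"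
        using F2_kernel[OF I, of "\<lambda>i j. lookup (quo (Gb j k) (y i)) []"] by blast
      obtain j0 where j0: "j0 \<in> L" using L(2) by blast
      have finL: "finite L" using L(1) finite_subset by blast
      define Y where "Y i = (\<Sum>j\<in>L. quo (Gb j k) (y i))" for i
      have Y0: "lookup (Y i) [] = 0" if "i \<in> I" for i
        using L(3)[OF that] by (simp only: Y_def lookup_sum)
      \<comment> \<open>Comparing the parts that end in the letters \<open>a l j0\<close> expresses \<open>h j\<close> a second time by the \<open>x i\<close>.\<close>
      have hY: "h j = (\<Sum>i\<in>I. mul n False (x i) (swap j0 j (Y i)))" if "j < n" for j
      proof -
        have "(\<Sum>i\<in>I. mul n False (x i) (swap j0 j (Y i)))
            = swap j0 j (\<Sum>i\<in>I. mul n False (x i) (Y i))"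
          unfolding swap_sum using Y0 by (intro sum.cong) (auto simp: swap_mul)
        also have "(\<Sum>i\<in>I. mul n False (x i) (Y i)) = (\<Sum>j\<in>L. h j)"
          unfolding Y_def h_def mul_sum_right by (rule sum.swap)
        also have "\<dots> = (\<Sum>j\<in>L. swap 0 j (h 0))"
          using L(1) h by (intro sum.cong) auto
        also have "swap j0 j \<dots> = (\<Sum>m\<in>L. if m = j0 then swap 0 j (h 0) else 0)"
          unfolding swap_sum swap_swap ..
        also have "\<dots> = h j"
          using finL j0 h[OF that] by simp
        finally show ?thesis ..
      qed
      have quo_eq: "quo (Gb j k) (y i) = swap j0 j (Y i)" if "j < n" and i: "i \<in> I" for i j
      proof -
        have "quo (Gb j k) (y i) + swap j0 j (Y i) = 0"
        proof (rule IH[OF _ _ _ i])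
          show "(\<Sum>i\<in>I. mul n False (x i) (quo (Gb j k) (y i) + swap j0 j (Y i))) = 0"
            using hY[OF that(1)] unfolding mul_add_right sum.distrib h_def by simp
          show "supported good (quo (Gb j k) (y i) + swap j0 j (Y i))" if "i \<in> I" for i
            unfolding Y_def using that
            by (intro supported_add supported_swap[where P = good] supported_sum sup_quo)
              (auto intro: good_Ga)
          show "supported (\<lambda>w. length w + d i = D - 1) (quo (Gb j k) (y i) + swap j0 j (Y i))"
            if "i \<in> I" for i
            unfolding Y_def using that
            by (intro supported_add supported_sum sup_quo
                supported_swap[where P = "\<lambda>w. length w + d i = D - 1"]) auto
        qed
        then show ?thesis by (simp only: add_eq_0_iff_F2)
      qed
      \<comment> \<open>As \<open>y i\<close> is normal, its words ending in \<open>b 0 k\<close> do not end in \<open>a l 0 * b 0 k\<close>.\<close>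
      have "swap 0 j (quo (Gb 0 k) (y i)) = 0"
      proof -
        have "supported (\<lambda>t. \<not> reducible (Gb 0 k) t) (quo (Gb 0 k) (y i))"
          by (rule supported_quo[OF y(1)[OF i]]) (simp add: good_def)
        then have "supported (\<lambda>w. False) (swap 0 j (quo (Gb 0 k) (y i)))"
          by (rule supported_swap) simp
        then show ?thesis by (rule supported_FalseD)
      qed
      moreover have "swap 0 j (quo (Gb 0 k) (y i)) = swap j0 j (Y i)"
        using quo_eq[OF _ i, of 0] j by (simp add: swap_swap)
      ultimately show ?thesis using quo_eq[OF j i] by simp
    qed
    show ?thesis
    proof (rule eq_0_if_quo_eq_0)
      fix z
      consider "z = Ge" | j k where "z = Gb j k" "j < n" | "z \<noteq> Ge" "\<And>j k. z = Gb j k \<Longrightarrow> j \<ge> n"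
        by (cases z) (auto simp: not_less[symmetric])
      then show "quo z (y i) = 0"
      proof cases
        case 1
        then show ?thesis
          by (intro supported_FalseD supported_quo[OF y(1)[OF less.prems(4)]]) (simp add: good_def)
      qed (use free bound less.prems(4) in auto)
    qed (rule const[OF less.prems(4)])
  qed
qed

section \<open>The weak algorithm\<close>

text \<open>The part of an element that consists of the words with a given property.\<close>

definition part :: "('w \<Rightarrow> bool) \<Rightarrow> ('w \<Rightarrow>\<^sub>0 bit) \<Rightarrow> 'w \<Rightarrow>\<^sub>0 bit"
  where "part P = lin (\<lambda>w. if P w then basis w else 0)"

lemma additive_part: "Modules.additive (part P)"
  unfolding part_def by (rule additive_lin)

lemmas part_sum = additive.sum[OF additive_part]
lemmas part_diff = additive.diff[OF additive_part]
lemmas part_0 [simp] = additive.zero[OF additive_part]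

lemma part_basis [simp]: "part P (basis w) = (if P w then basis w else 0)"
  by (simp add: part_def)

lemma lookup_part: "lookup (part P v) w = (if P w then lookup v w else 0)"
proof (rule additive_eqI[where F = "\<lambda>v. lookup (part P v) w" and G = "\<lambda>v. if P w then lookup v w else 0"])
  show "Modules.additive (\<lambda>v. if P w then lookup v w else 0)"
    by (intro additive_if additive_lookup additive_zero)
qed (auto intro: additive_compose[OF additive_lookup additive_part] simp: lookup_single when_def)

lemma supported_part: "supported Q v \<Longrightarrow> supported (\<lambda>w. P w \<and> Q w) (part P v)"
  by (auto simp: supported_def in_keys_iff lookup_part split: if_splits)

lemma part_eq_self: "supported P v \<Longrightarrow> part P v = v"
  by (rule poly_mapping_eqI) (auto simp: supported_def lookup_part in_keys_iff)

lemma part_eq_0_iff: "part P v = 0 \<longleftrightarrow> supported (\<lambda>w. \<not> P w) v"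
  by (auto simp: poly_mapping_eq_iff fun_eq_iff supported_def lookup_part in_keys_iff)

lemma top_act_word:
  assumes "length w \<le> p"
  shows "supported (\<lambda>w. length w \<le> Suc p) (act n True x w)"
    and "part (\<lambda>w. length w = Suc p) (act n True x w) =
      lin (act n False x) (part (\<lambda>w. length w = p) (basis w))"
proof -
  have "supported (\<lambda>w. length w \<le> Suc p) (act n True x w) \<and>
    part (\<lambda>w. length w = Suc p) (act n True x w) =
      lin (act n False x) (part (\<lambda>w. length w = p) (basis w))"
  proof (cases "reducible x w")
    case False
    then show ?thesis using assms by (auto simp: act_irreducible)
  next
    case True
    then show ?thesis
      using assms
      by (elim reducibleE)
        (auto intro!: supported_add supported_sum simp: additive.add[OF additive_part] part_sum)
  qed
  then show "supported (\<lambda>w. length w \<le> Suc p) (act n True x w)"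
    "part (\<lambda>w. length w = Suc p) (act n True x w) =
      lin (act n False x) (part (\<lambda>w. length w = p) (basis w))"
    by simp_all
qed

lemma top_word_act:
  assumes "supported (\<lambda>w. length w \<le> d) u"
  shows "supported (\<lambda>w. length w \<le> d + length t) (word_act n True t u) \<and>
    part (\<lambda>w. length w = d + length t) (word_act n True t u)
      = word_act n False t (part (\<lambda>w. length w = d) u)"
proof (induction t)
  case Nil
  then show ?case using assms by simp
next
  case (Cons x t)
  let ?p = "d + length t" and ?v = "word_act n True t u"
  from Cons have v: "supported (\<lambda>w. length w \<le> ?p) ?v"
    and top: "part (\<lambda>w. length w = ?p) ?v = word_act n False t (part (\<lambda>w. length w = d) u)"
    by auto
  have "supported (\<lambda>w. length w \<le> Suc ?p) (lin (act n True x) ?v)"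
    using v by (rule supported_lin) (rule top_act_word)
  moreover have "part (\<lambda>w. length w = Suc ?p) (lin (act n True x) ?v)
      = lin (act n False x) (part (\<lambda>w. length w = ?p) ?v)"
  proof (rule additive_eqI[where v = ?v])
    show "part (\<lambda>w. length w = Suc ?p) (lin (act n True x) (basis w))
      = lin (act n False x) (part (\<lambda>w. length w = ?p) (basis w))" if "w \<in> keys ?v" for w
      using top_act_word(2)[where w = w and p = ?p and n = n and x = x] v that
      by (simp add: supported_def)
  qed (rule additive_compose[OF additive_part additive_lin] additive_compose[OF additive_lin additive_part])+
  ultimately show ?case by (simp add: top)
qed

text \<open>The multiplication of the associated graded ring describes the top component of
  products.\<close>

lemma top_mul:
  assumes "supported (\<lambda>w. length w \<le> d) u" "supported (\<lambda>w. length w + d \<le> D) v"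
  shows "supported (\<lambda>w. length w \<le> D) (mul n True u v)"
    and "part (\<lambda>w. length w = D) (mul n True u v)
      = mul n False (part (\<lambda>w. length w = d) u) (part (\<lambda>w. length w + d = D) v)"
proof -
  show "supported (\<lambda>w. length w \<le> D) (mul n True u v)"
    unfolding mul_def
  proof (rule supported_lin[OF assms(2)])
    show "supported (\<lambda>w. length w \<le> D) (word_act n True t u)" if "length t + d \<le> D" for t
      using top_word_act[OF assms(1), where n = n and t = t] that by (auto intro: supported_mono)
  qed
  let ?F = "\<lambda>v. part (\<lambda>w. length w = D) (mul n True u v)"
  let ?G = "\<lambda>v. mul n False (part (\<lambda>w. length w = d) u) (part (\<lambda>w. length w + d = D) v)"
  show "?F v = ?G v"
  proof (rule additive_eqI[where F = ?F and G = ?G])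
    fix t assume "t \<in> keys v"
    with assms(2) have "length t + d \<le> D" by (simp add: supported_def)
    then consider "length t + d = D" | "length t + d < D" by linarith
    then show "?F (basis t) = ?G (basis t)"
    proof cases
      case 1
      then have "d + length t = D" by simp
      with top_word_act[OF assms(1), where n = n and t = t] show ?thesis using 1 by simp
    next
      case 2
      have "part (\<lambda>w. length w = D) (word_act n True t u) = 0"
        unfolding part_eq_0_iff using top_word_act[OF assms(1), where n = n and t = t] 2
        by (auto intro: supported_mono)
      then show ?thesis using 2 by simp
    qed
  qed (rule additive_compose[OF additive_part additive_mul_right]
      additive_compose[OF additive_mul_right additive_part])+
qed

text \<open>The degree is the maximal length of a word plus 1, so that 0 is the only element of degree 0.\<close>

definition deg :: "(gen list \<Rightarrow>\<^sub>0 bit) \<Rightarrow> nat"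
  where "deg v = Max (insert 0 ((\<lambda>w. Suc (length w)) ` keys v))"

lemma deg_le_iff: "deg v \<le> m \<longleftrightarrow> supported (\<lambda>w. length w < m) v"
  by (auto simp: deg_def supported_def)

lemma deg_eq_0_iff: "deg v = 0 \<longleftrightarrow> v = 0"
  using deg_le_iff[of v 0] by (auto dest: supported_FalseD)

text \<open>If the leading terms of the \<open>x i\<close> were independent in the graded ring, the leading terms of a
  relation between the \<open>x i\<close> would vanish.  Therefore one of them depends on the others, and
  subtracting the corresponding combination lowers the degree.\<close>

lemma weak_algorithm:
  fixes x y :: "nat \<Rightarrow> gen list \<Rightarrow>\<^sub>0 bit"
  assumes I: "finite I" "card I < n"
    and x: "\<And>i. i \<in> I \<Longrightarrow> x i \<noteq> 0"
    and y: "\<And>i. i \<in> I \<Longrightarrow> supported good (y i)"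
    and rel: "(\<Sum>i\<in>I. mul n True (x i) (y i)) = 0"
    and nonzero: "\<exists>i\<in>I. y i \<noteq> 0"
  obtains i z where "i \<in> I" "\<And>j. j \<in> I \<Longrightarrow> supported good (z j)"
    "deg (x i - (\<Sum>j\<in>I - {i}. mul n True (x j) (z j))) < deg (x i)"
proof (rule ccontr)
  assume "\<not> thesis"
  with that have irred: "\<not> deg (x i - (\<Sum>j\<in>I - {i}. mul n True (x j) (z j))) < deg (x i)"
    if "i \<in> I" "\<And>j. j \<in> I \<Longrightarrow> supported good (z j)" for i z
    using that by blast
  define d where "d i = deg (x i) - 1" for i
  define X where "X i = part (\<lambda>w. length w = d i) (x i)" for i
  have deg_x: "deg (x i) = Suc (d i)" if "i \<in> I" for i
    using x[OF that] deg_eq_0_iff[of "x i"] by (simp add: d_def)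
  have sup_x: "supported (\<lambda>w. length w \<le> d i) (x i)" if "i \<in> I" for i
    using deg_le_iff[of "x i" "Suc (d i)"] deg_x[OF that] by (simp add: less_Suc_eq_le)
  define bound where "bound D \<longleftrightarrow> (\<forall>i\<in>I. supported (\<lambda>w. length w + d i \<le> D) (y i))" for D
  \<comment> \<open>The degree of the relation: the maximal degree of a product \<open>x i * y i\<close>.\<close>
  define D where "D = (LEAST D. bound D)"
  have "bound (\<Sum>i\<in>I. deg (y i) + d i)"
    unfolding bound_def
  proof
    fix i assume "i \<in> I"
    then have le: "deg (y i) + d i \<le> (\<Sum>i\<in>I. deg (y i) + d i)"
      using I(1) by (intro member_le_sum) auto
    have "supported (\<lambda>w. length w < deg (y i)) (y i)"
      using deg_le_iff by blast
    then show "supported (\<lambda>w. length w + d i \<le> (\<Sum>i\<in>I. deg (y i) + d i)) (y i)"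
      using le by (auto intro: supported_mono)
  qed
  then have "bound D" unfolding D_def by (rule LeastI)
  then have sup_y: "supported (\<lambda>w. length w + d i \<le> D) (y i)" if "i \<in> I" for i
    using that by (simp add: bound_def)
  define Y where "Y i = part (\<lambda>w. length w + d i = D) (y i)" for i
  have "Y i = 0" if "i \<in> I" for i
  proof (rule graded_independent[OF I _ _ _ _ that, where d = d and D = D])
    show "supported good (Y i)" if "i \<in> I" for i
      using supported_part[OF y[OF that]] by (auto simp: Y_def intro: supported_mono)
    show "supported (\<lambda>w. length w + d i = D) (Y i)" if "i \<in> I" for i
      using supported_part[OF y[OF that]] by (auto simp: Y_def intro: supported_mono)
    have "(\<Sum>i\<in>I. mul n False (X i) (Y i)) = part (\<lambda>w. length w = D) (\<Sum>i\<in>I. mul n True (x i) (y i))"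
      unfolding part_sum X_def Y_def using top_mul(2)[OF sup_x sup_y] by (intro sum.cong) auto
    then show "(\<Sum>i\<in>I. mul n False (X i) (Y i)) = 0" by (simp add: rel)
    fix i z
    assume i: "i \<in> I" and z: "\<And>j. j \<in> I \<Longrightarrow> supported good (z j)"
      "\<And>j. j \<in> I \<Longrightarrow> supported (\<lambda>w. length w + d j = d i) (z j)"
    show "X i \<noteq> (\<Sum>j\<in>I - {i}. mul n False (X j) (z j))"
    proof
      assume dep: "X i = (\<Sum>j\<in>I - {i}. mul n False (X j) (z j))"
      let ?r = "x i - (\<Sum>j\<in>I - {i}. mul n True (x j) (z j))"
      have sup_z: "supported (\<lambda>w. length w + d j \<le> d i) (z j)" if "j \<in> I" for j
        using z(2)[OF that] by (auto intro: supported_mono)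
      have "part (\<lambda>w. length w = d i) (\<Sum>j\<in>I - {i}. mul n True (x j) (z j))
          = (\<Sum>j\<in>I - {i}. mul n False (X j) (z j))"
        unfolding part_sum X_def
        using top_mul(2)[OF sup_x sup_z] part_eq_self[OF z(2)] by (intro sum.cong) auto
      then have "part (\<lambda>w. length w = d i) ?r = 0"
        using dep by (simp add: part_diff X_def)
      moreover have "supported (\<lambda>w. length w \<le> d i) ?r"
        using i by (intro supported_diff sup_x supported_sum top_mul(1)[OF sup_x sup_z]) auto
      ultimately have "supported (\<lambda>w. length w < d i) ?r"
        unfolding part_eq_0_iff by (auto simp: supported_def order.order_iff_strict)
      then have "deg ?r \<le> d i" by (simp add: deg_le_iff)
      moreover have "\<not> deg ?r < deg (x i)" using i z(1) by (rule irred)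
      ultimately show False using deg_x[OF i] by simp
    qed
  qed
  then have lower: "supported (\<lambda>w. length w + d i < D) (y i)" if "i \<in> I" for i
    using sup_y[OF that] that unfolding Y_def part_eq_0_iff
    by (auto simp: supported_def order.order_iff_strict)
  show False
  proof (cases D)
    case 0
    with lower have "y i = 0" if "i \<in> I" for i
      using that by (intro supported_FalseD) auto
    with nonzero show False by blast
  next
    case (Suc D')
    with lower have "bound D'"
      unfolding bound_def by (auto simp: less_Suc_eq_le)
    then have "D \<le> D'" unfolding D_def by (rule Least_le)
    with Suc show False by simp
  qed
qed

section \<open>Rings in which matrices of small inner size have no right inverse\<close>

text \<open>A biadditive associative product on an abelian group and a subset \<open>S\<close> closed under it take the
  place of a ring; no unit law is needed.  The function \<open>delta\<close> stands for a degree, and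
  the hypothesis \<open>weak\<close> is the weak algorithm for fewer than \<open>n\<close> elements.\<close>

lemma no_right_inverse:
  fixes M :: "'a::ab_group_add \<Rightarrow> 'a \<Rightarrow> 'a" and delta :: "'a \<Rightarrow> nat" and u :: 'a
  assumes M_left: "\<And>v. Modules.additive (\<lambda>u. M u v)"
    and M_right: "\<And>u. Modules.additive (M u)"
    and M_assoc: "\<And>u v w. M (M u v) w = M u (M v w)"
    and S: "\<And>u v. u \<in> S \<Longrightarrow> v \<in> S \<Longrightarrow> M u v \<in> S"
      "\<And>u v. u \<in> S \<Longrightarrow> v \<in> S \<Longrightarrow> u + v \<in> S" "\<And>u v. u \<in> S \<Longrightarrow> v \<in> S \<Longrightarrow> u - v \<in> S" "0 \<in> S"
    and u: "u \<noteq> 0"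
    and weak: "\<And>(I :: nat set) x y. finite I \<Longrightarrow> card I < n \<Longrightarrow> (\<And>i. i \<in> I \<Longrightarrow> x i \<in> S) \<Longrightarrow> (\<And>i. i \<in> I \<Longrightarrow> x i \<noteq> 0)
      \<Longrightarrow> (\<And>i. i \<in> I \<Longrightarrow> y i \<in> S) \<Longrightarrow> (\<Sum>i\<in>I. M (x i) (y i)) = 0 \<Longrightarrow> \<exists>i\<in>I. y i \<noteq> 0
      \<Longrightarrow> \<exists>i\<in>I. \<exists>z. (\<forall>j\<in>I. z j \<in> S) \<and> delta (x i - (\<Sum>j\<in>I - {i}. M (x j) (z j))) < delta (x i)"
    and fin: "finite (J :: nat set)" "finite (K :: nat set)" "card J < card K" "card J < n"
    and C: "\<And>i j. i \<in> K \<Longrightarrow> j \<in> J \<Longrightarrow> C i j \<in> S"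
    and D: "\<And>j k. j \<in> J \<Longrightarrow> k \<in> K \<Longrightarrow> D j k \<in> S"
    and CD: "\<And>i k. i \<in> K \<Longrightarrow> k \<in> K \<Longrightarrow> (\<Sum>j\<in>J. M (C i j) (D j k)) = (if i = k then u else 0)"
  shows False
proof -
  have main: False
    if "finite J" "finite (K :: nat set)" "card J < card K" "card J < n" "k0 \<in> K"
      "\<And>i j. i \<in> K \<Longrightarrow> j \<in> J \<Longrightarrow> C i j \<in> S" "\<And>j k. j \<in> J \<Longrightarrow> k \<in> K \<Longrightarrow> D j k \<in> S"
      "\<And>i k. i \<in> K \<Longrightarrow> k \<in> K \<Longrightarrow> (\<Sum>j\<in>J. M (C i j) (D j k)) = (if i = k then u else 0)"
    for J :: "nat set" and K k0 C D
    using that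
  proof (induction "card J" arbitrary: J K k0 C D rule: less_induct)
    case less
    note outer = less.hyps
    from less.prems show False
    proof (induction "\<Sum>j\<in>J. delta (C k0 j)" arbitrary: C D rule: less_induct)
      case less
      note fin = less.prems(1,2) and card_less = less.prems(3) and card_n = less.prems(4)
        and k0 = less.prems(5) and C = less.prems(6) and D = less.prems(7) and CD = less.prems(8)
      define I where "I = {j \<in> J. C k0 j \<noteq> 0}"
      have I: "finite I" "I \<subseteq> J" using fin by (auto simp: I_def)
      have card_I: "card I < n" using card_mono[OF fin(1) I(2)] card_n by simp
      have row: "(\<Sum>j\<in>I. M (C k0 j) (D j k)) = (if k0 = k then u else 0)" if "k \<in> K" for k
      proof -
        have "(\<Sum>j\<in>I. M (C k0 j) (D j k)) = (\<Sum>j\<in>J. M (C k0 j) (D j k))"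
          using fin by (intro sum.mono_neutral_left) (auto simp: I_def additive.zero[OF M_left])
        then show ?thesis using CD[OF k0 that] by simp
      qed
      have "I \<noteq> {}" using row[OF k0] u by auto
      show False
      proof (cases "\<forall>k\<in>K - {k0}. \<forall>j\<in>I. D j k = 0")
        \<comment> \<open>Delete row \<open>k0\<close> and column \<open>i\<close> of \<open>C\<close>, and row \<open>i\<close> and column \<open>k0\<close> of \<open>D\<close>.\<close>
        case True
        obtain i where i: "i \<in> I" using \<open>I \<noteq> {}\<close> by blast
        then have "i \<in> J" using I by blast
        then have cards: "card (J - {i}) < card J" "Suc (card (J - {i})) = card J"
          using card_Diff1_less[OF fin(1)] card_Suc_Diff1[OF fin(1)] by blast+
        have card_K: "Suc (card (K - {k0})) = card K"
          using fin k0 by (metis card_Suc_Diff1)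
        then have "card (K - {k0}) \<noteq> 0" using cards card_less by linarith
        then have "K - {k0} \<noteq> {}" by (metis card.empty)
        then obtain k1 where k1: "k1 \<in> K - {k0}" by blast
        show False
        proof (rule outer[of "J - {i}" "K - {k0}" k1 C D])
          show "(\<Sum>j\<in>J - {i}. M (C i' j) (D j k)) = (if i' = k then u else 0)"
            if "i' \<in> K - {k0}" "k \<in> K - {k0}" for i' k
          proof -
            have "D i k = 0" using True that i by blast
            then have "(\<Sum>j\<in>J. M (C i' j) (D j k)) = (\<Sum>j\<in>J - {i}. M (C i' j) (D j k))"
              using fin \<open>i \<in> J\<close> by (simp add: sum.remove additive.zero[OF M_right])
            then show ?thesis using CD that by auto
          qed
        qed (use fin cards card_K card_less card_n k1 C D in auto)
      next
        case False
        then obtain k where k: "k \<in> K" "k \<noteq> k0" "\<exists>j\<in>I. D j k \<noteq> 0" by blast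
        have "\<exists>i\<in>I. \<exists>z. (\<forall>j\<in>I. z j \<in> S) \<and>
            delta (C k0 i - (\<Sum>j\<in>I - {i}. M (C k0 j) (z j))) < delta (C k0 i)"
          using I card_I k C D k0 row[OF k(1)] by (intro weak[where y = "\<lambda>j. D j k"]) (auto simp: I_def)
        then obtain i z where i: "i \<in> I" and z: "\<And>j. j \<in> I \<Longrightarrow> z j \<in> S"
          and less: "delta (C k0 i - (\<Sum>j\<in>I - {i}. M (C k0 j) (z j))) < delta (C k0 i)"
          by blast
        have "i \<in> J" using i I by blast
        \<comment> \<open>An elementary column operation on \<open>C\<close> and the inverse row operation on \<open>D\<close>.\<close>
        define C' where "C' r j = (if j = i then C r i - (\<Sum>j\<in>I - {i}. M (C r j) (z j)) else C r j)" for r j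
        define D' where "D' j k = (if j \<in> I - {i} then D j k + M (z j) (D i k) else D j k)" for j k
        have S_sum: "(\<Sum>j\<in>A. f j) \<in> S" if "\<And>j. j \<in> A \<Longrightarrow> f j \<in> S" for A :: "nat set" and f
          using that by (induction A rule: infinite_finite_induct) (auto intro: S)
        show False
        proof (rule less.hyps[of C' D'])
          show "(\<Sum>j\<in>J. delta (C' k0 j)) < (\<Sum>j\<in>J. delta (C k0 j))"
            using fin less \<open>i \<in> J\<close> by (intro sum_strict_mono_ex1) (auto simp: C'_def)
          show "C' r j \<in> S" if "r \<in> K" "j \<in> J" for r j
            using that C z I \<open>i \<in> J\<close> by (auto simp: C'_def intro!: S S_sum)
          show "D' j k \<in> S" if "j \<in> J" "k \<in> K" for j k
            using that D z I \<open>i \<in> J\<close> by (auto simp: D'_def intro!: S)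
          show "(\<Sum>j\<in>J. M (C' r j) (D' j k)) = (if r = k then u else 0)" if "r \<in> K" "k \<in> K" for r k
          proof -
            let ?E = "\<Sum>j\<in>I - {i}. M (C r j) (M (z j) (D i k))"
            have "(\<Sum>j\<in>J - {i}. M (C' r j) (D' j k))
                = (\<Sum>j\<in>J - {i}. M (C r j) (D j k) + (if j \<in> I - {i} then M (C r j) (M (z j) (D i k)) else 0))"
              by (intro sum.cong) (auto simp: C'_def D'_def additive.add[OF M_right])
            also have "\<dots> = (\<Sum>j\<in>J - {i}. M (C r j) (D j k)) + ?E"
            proof -
              have "(\<Sum>j\<in>J - {i}. if j \<in> I - {i} then M (C r j) (M (z j) (D i k)) else 0) = ?E"
                using fin I by (intro sum.mono_neutral_cong_right) auto
              then show ?thesis by (simp only: sum.distrib)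
            qed
            finally have "(\<Sum>j\<in>J - {i}. M (C' r j) (D' j k)) = (\<Sum>j\<in>J - {i}. M (C r j) (D j k)) + ?E" .
            moreover have "M (C' r i) (D' i k) = M (C r i) (D i k) - ?E"
              by (simp add: C'_def D'_def additive.diff[OF M_left] additive.sum[OF M_left] M_assoc)
            ultimately have "(\<Sum>j\<in>J. M (C' r j) (D' j k)) = (\<Sum>j\<in>J. M (C r j) (D j k))"
              using fin \<open>i \<in> J\<close> by (simp add: sum.remove)
            then show ?thesis using CD that by simp
          qed
        qed (use fin card_less card_n k0 in auto)
      qed
    qed
  qed
  have "K \<noteq> {}" using fin by auto
  then obtain k0 where "k0 \<in> K" by blast
  from main[OF fin this C D CD] show False .
qed

lemma supported_good_mul:
  assumes "supported good u" "supported good v"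
  shows "supported good (mul n q u v)"
proof (rule supported_mul[OF assms])
  show "supported good (act n q x w)" if "good (x # t)" "good w" for x t w
  proof (cases "reducible x w")
    case True
    then show ?thesis
      using that by (elim reducibleE) (auto simp: good_def intro!: supported_add supported_sum)
  next
    case False
    then show ?thesis using that by (auto simp: act_irreducible good_def)
  qed
qed (auto dest: good_tl)

lemma no_right_inverse_mul:
  assumes "m < n"
    and C: "\<And>i j. i \<le> m \<Longrightarrow> j < m \<Longrightarrow> supported good (C i j)"
    and D: "\<And>j k. j < m \<Longrightarrow> k \<le> m \<Longrightarrow> supported good (D j k)"
    and CD: "\<And>i k. i \<le> m \<Longrightarrow> k \<le> m \<Longrightarrow>
      (\<Sum>j<m. mul n True (C i j) (D j k)) = (if i = k then basis [] else 0)"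
  shows False
proof (rule no_right_inverse[where M = "mul n True" and S = "{v. supported good v}" and delta = deg
      and u = "basis []" and n = n and J = "{..<m}" and K = "{..m}" and C = C and D = D])
  show "\<exists>i\<in>I. \<exists>z. (\<forall>j\<in>I. z j \<in> {v. supported good v}) \<and>
      deg (x i - (\<Sum>j\<in>I - {i}. mul n True (x j) (z j))) < deg (x i)"
    if "finite I" "card I < n" "\<And>i. i \<in> I \<Longrightarrow> x i \<noteq> 0" "\<And>i. i \<in> I \<Longrightarrow> y i \<in> {v. supported good v}"
      "(\<Sum>i\<in>I. mul n True (x i) (y i)) = 0" "\<exists>i\<in>I. y i \<noteq> 0"
    for I and x y :: "nat \<Rightarrow> gen list \<Rightarrow>\<^sub>0 bit"
  proof -
    have y: "supported good (y i)" if "i \<in> I" for i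
      using \<open>\<And>i. i \<in> I \<Longrightarrow> y i \<in> {v. supported good v}\<close> that by simp
    show ?thesis
      by (rule weak_algorithm[OF that(1-3) y that(5,6)]) auto
  qed
  show "basis [] \<noteq> (0 :: gen list \<Rightarrow>\<^sub>0 bit)"
    by (metis lookup_single_eq lookup_zero zero_neq_one)
qed (use assms in \<open>auto simp: mul_assoc intro: additive_mul_left additive_mul_right
    supported_good_mul supported_add supported_diff\<close>)

section \<open>Epimorphisms of free modules as matrices\<close>

text \<open>An epimorphism of free modules and a choice of preimages of the unit vectors give matrices \<open>C\<close>
  and \<open>D\<close> whose product is the identity.  The identity is stated for the images under a map \<open>\<psi>\<close> that
  preserves addition and multiplication, where \<open>M\<close> is the product on the target.\<close>

lemma epi_matrices:
  fixes \<psi> :: "'a \<Rightarrow> 'b::ab_group_add" and M :: "'b \<Rightarrow> 'b \<Rightarrow> 'b"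
  assumes "ring S" and f: "f \<in> rmodule_epi S (free_rmodule S p) (free_rmodule S q)"
    and add: "\<And>x y. x \<in> carrier S \<Longrightarrow> y \<in> carrier S \<Longrightarrow> \<psi> (x \<oplus>\<^bsub>S\<^esub> y) = \<psi> x + \<psi> y"
    and mult: "\<And>x y. x \<in> carrier S \<Longrightarrow> y \<in> carrier S \<Longrightarrow> \<psi> (x \<otimes>\<^bsub>S\<^esub> y) = M (\<psi> x) (\<psi> y)"
  obtains C D where
    "\<And>i j. i < q \<Longrightarrow> j < p \<Longrightarrow> C i j \<in> carrier S"
    "\<And>j k. j < p \<Longrightarrow> k < q \<Longrightarrow> D j k \<in> carrier S"
    "\<And>i k. i < q \<Longrightarrow> k < q \<Longrightarrow>
      (\<Sum>j<p. M (\<psi> (C i j)) (\<psi> (D j k))) = (if i = k then \<psi> \<one>\<^bsub>S\<^esub> else 0)"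
proof -
  interpret S: ring S by fact
  let ?P = "free_rmodule S p" and ?Q = "free_rmodule S q"
  have mem: "x \<in> carrier (free_rmodule S r) \<longleftrightarrow> (\<forall>i<r. x i \<in> carrier S) \<and> x \<in> extensional {..<r}" for x r
    by (auto simp: free_rmodule_def PiE_def Pi_def)
  have ops: "(x \<oplus>\<^bsub>free_rmodule S r\<^esub> y) = (\<lambda>i\<in>{..<r}. x i \<oplus>\<^bsub>S\<^esub> y i)"
    "x \<triangleleft>\<^bsub>free_rmodule S r\<^esub> c = (\<lambda>i\<in>{..<r}. x i \<otimes>\<^bsub>S\<^esub> c)" for x y r c
    by (simp_all add: free_rmodule_def)
  have f_closed: "f x \<in> carrier ?Q" if "x \<in> carrier ?P" for x
    using f that by (auto simp: rmodule_epi_def rmodule_hom_def)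
  have f_coord: "f x i \<in> carrier S" if "x \<in> carrier ?P" "i < q" for x i
    using f_closed[OF that(1)] that(2) by (simp add: mem)
  have f_add: "f (x \<oplus>\<^bsub>?P\<^esub> y) = f x \<oplus>\<^bsub>?Q\<^esub> f y" if "x \<in> carrier ?P" "y \<in> carrier ?P" for x y
    using f that by (auto simp: rmodule_epi_def rmodule_hom_def)
  have f_smult: "f (x \<triangleleft>\<^bsub>?P\<^esub> r) = f x \<triangleleft>\<^bsub>?Q\<^esub> r" if "x \<in> carrier ?P" "r \<in> carrier S" for x r
    using f that by (auto simp: rmodule_epi_def rmodule_hom_def)
  have f_surj: "f ` carrier ?P = carrier ?Q"
    using f by (simp add: rmodule_epi_def)
  define E where "E r k = (\<lambda>i\<in>{..<r}. if i = k then \<one>\<^bsub>S\<^esub> else \<zero>\<^bsub>S\<^esub>)" for r k :: nat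
  have E: "E r k \<in> carrier (free_rmodule S r)" for r k
    by (simp add: mem E_def)
  have \<psi>_zero: "\<psi> \<zero>\<^bsub>S\<^esub> = 0"
    using add[of "\<zero>\<^bsub>S\<^esub>" "\<zero>\<^bsub>S\<^esub>"] by simp
  have expand: "\<psi> (f x i) = (\<Sum>j<m. M (\<psi> (f (E p j) i)) (\<psi> (x j)))"
    if "m \<le> p" "x \<in> carrier ?P" "i < q" "\<And>j. m \<le> j \<Longrightarrow> j < p \<Longrightarrow> x j = \<zero>\<^bsub>S\<^esub>" for m x i
    using that
  proof (induction m arbitrary: x)
    case 0
    have "x \<oplus>\<^bsub>?P\<^esub> x = x"
      using 0 by (intro extensionalityI[of _ "{..<p}"]) (simp_all add: mem ops)
    then have "f x = f x \<oplus>\<^bsub>?Q\<^esub> f x"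
      using f_add[of x x] 0 by simp
    then have "f x i = f x i \<oplus>\<^bsub>S\<^esub> f x i"
      using 0(3) by (simp add: ops fun_eq_iff) metis
    then have "\<psi> (f x i) = \<psi> (f x i) + \<psi> (f x i)"
      using add[of "f x i" "f x i"] f_coord 0 by simp
    then show ?case by simp
  next
    case (Suc m)
    let ?x' = "\<lambda>i\<in>{..<p}. if i = m then \<zero>\<^bsub>S\<^esub> else x i"
    have x': "?x' \<in> carrier ?P" and xm: "x m \<in> carrier S"
      using Suc.prems by (auto simp: mem)
    have Ex: "E p m \<triangleleft>\<^bsub>?P\<^esub> x m \<in> carrier ?P"
      using xm by (simp add: mem ops E_def)
    have "x = ?x' \<oplus>\<^bsub>?P\<^esub> E p m \<triangleleft>\<^bsub>?P\<^esub> x m"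
      using Suc.prems by (intro extensionalityI[of _ "{..<p}"]) (auto simp: mem ops E_def)
    then have "f x = f ?x' \<oplus>\<^bsub>?Q\<^esub> (f (E p m) \<triangleleft>\<^bsub>?Q\<^esub> x m)"
      using f_add[OF x' Ex] f_smult[OF E xm] by simp
    then have "f x i = f ?x' i \<oplus>\<^bsub>S\<^esub> f (E p m) i \<otimes>\<^bsub>S\<^esub> x m"
      using Suc.prems(3) by (simp add: ops)
    then have "\<psi> (f x i) = \<psi> (f ?x' i) + M (\<psi> (f (E p m) i)) (\<psi> (x m))"
      using f_coord x' E xm Suc.prems(3) by (simp add: add mult)
    also have "\<psi> (f ?x' i) = (\<Sum>j<m. M (\<psi> (f (E p j) i)) (\<psi> (?x' j)))"
      using Suc.prems by (intro Suc.IH x') (auto simp: less_Suc_eq_le)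
    also have "\<dots> = (\<Sum>j<m. M (\<psi> (f (E p j) i)) (\<psi> (x j)))"
      using Suc.prems by (intro sum.cong) auto
    finally show ?case by simp
  qed
  have "\<forall>k. \<exists>x. x \<in> carrier ?P \<and> f x = E q k"
    using f_surj E[of q] by (metis image_iff)
  then obtain X where X: "\<And>k. X k \<in> carrier ?P" "\<And>k. f (X k) = E q k" by metis
  show thesis
  proof (rule that[of "\<lambda>i j. f (E p j) i" "\<lambda>j k. X k j"])
    show "(\<Sum>j<p. M (\<psi> (f (E p j) i)) (\<psi> (X k j))) = (if i = k then \<psi> \<one>\<^bsub>S\<^esub> else 0)"
      if "i < q" "k < q" for i k
    proof -
      have "(\<Sum>j<p. M (\<psi> (f (E p j) i)) (\<psi> (X k j))) = \<psi> (f (X k) i)"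
        by (rule expand[symmetric]) (use X that in auto)
      also have "f (X k) i = (if i = k then \<one>\<^bsub>S\<^esub> else \<zero>\<^bsub>S\<^esub>)"
        using that by (simp add: X(2) E_def)
      finally show ?thesis using \<psi>_zero by auto
    qed
  qed (use f_coord E X(1) mem in auto)
qed

text \<open>A matrix over the field with two elements that has more columns than rows has a nonzero vector in
  its kernel, so \<open>D\<close> cannot have a left inverse.\<close>

lemma has_UGN_if_F2_character:
  fixes \<psi> :: "'a \<Rightarrow> bit"
  assumes "ring S"
    and add: "\<And>x y. x \<in> carrier S \<Longrightarrow> y \<in> carrier S \<Longrightarrow> \<psi> (x \<oplus>\<^bsub>S\<^esub> y) = \<psi> x + \<psi> y"
    and mult: "\<And>x y. x \<in> carrier S \<Longrightarrow> y \<in> carrier S \<Longrightarrow> \<psi> (x \<otimes>\<^bsub>S\<^esub> y) = \<psi> x * \<psi> y"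
    and one: "\<psi> \<one>\<^bsub>S\<^esub> = 1"
  shows "has_UGN S"
  unfolding has_UGN_def
proof (intro allI impI notI, elim exE)
  fix p f
  assume f: "f \<in> rmodule_epi S (free_rmodule S p) (free_rmodule S (p + 1))"
  obtain C D where "\<And>i j. i < p + 1 \<Longrightarrow> j < p \<Longrightarrow> C i j \<in> carrier S"
    "\<And>j k. j < p \<Longrightarrow> k < p + 1 \<Longrightarrow> D j k \<in> carrier S"
    and CD: "\<And>i k. i < p + 1 \<Longrightarrow> k < p + 1 \<Longrightarrow>
      (\<Sum>j<p. \<psi> (C i j) * \<psi> (D j k)) = (if i = k then \<psi> \<one>\<^bsub>S\<^esub> else 0)"
    by (rule epi_matrices[OF assms(1) f add mult]) blast+
  obtain L where L: "L \<subseteq> {..<p + 1}" "L \<noteq> {}" "\<And>j. j \<in> {..<p} \<Longrightarrow> (\<Sum>k\<in>L. \<psi> (D j k)) = 0"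
    by (rule F2_kernel[of "{..<p}" "p + 1" "\<lambda>j k. \<psi> (D j k)"]) auto
  obtain i where i: "i \<in> L" using L(2) by blast
  have fin: "finite L" using L(1) finite_subset by blast
  have "1 = (\<Sum>k\<in>L. if i = k then 1 else 0 :: bit)"
    using i fin by simp
  also have "\<dots> = (\<Sum>k\<in>L. \<Sum>j<p. \<psi> (C i j) * \<psi> (D j k))"
    using L(1) i CD one by (intro sum.cong) (auto simp: subset_iff)
  also have "\<dots> = (\<Sum>j<p. \<psi> (C i j) * (\<Sum>k\<in>L. \<psi> (D j k)))"
    unfolding sum_distrib_left by (rule sum.swap)
  also have "\<dots> = 0"
    by (intro sum.neutral ballI) (simp only: L(3) mult_zero_right)
  finally show False by simp
qed

section \<open>The Peirce grading\<close>

text \<open>A ring with an idempotent \<open>e\<close>.\<close>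

locale peirce = ring R for R (structure) +
  fixes e
  assumes e_closed: "e \<in> carrier R" and e_idem: "e \<otimes> e = e"
begin

text \<open>The idempotents \<open>e\<close> and \<open>1 - e\<close> are indexed by the truth values.\<close>

definition idem :: "bool \<Rightarrow> 'a"
  where "idem a = (if a then e else \<one> \<ominus> e)"

text \<open>The projection to the Peirce component \<open>idem a R idem b\<close>.\<close>

definition corner :: "bool \<Rightarrow> bool \<Rightarrow> 'a \<Rightarrow> 'a"
  where "corner a b x = idem a \<otimes> x \<otimes> idem b"

lemma idem_closed [simp]: "idem a \<in> carrier R"
  using e_closed by (simp add: idem_def)

lemma idem_mult: "idem a \<otimes> idem b = (if a = b then idem a else \<zero>)"
  using e_closed by (auto simp: idem_def minus_eq l_distr r_distr l_minus r_minus e_idem a_ac r_neg r_neg1 r_neg2 minus_add)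

lemma idem_sum: "idem True \<oplus> idem False = \<one>"
  using e_closed by (simp add: idem_def minus_eq a_lcomm[of e] r_neg)

lemma corner_closed [simp]: "x \<in> carrier R \<Longrightarrow> corner a b x \<in> carrier R"
  by (simp add: corner_def)

lemma corner_zero [simp]: "corner a b \<zero> = \<zero>"
  by (simp add: corner_def)

lemma corner_add: "x \<in> carrier R \<Longrightarrow> y \<in> carrier R \<Longrightarrow> corner a b (x \<oplus> y) = corner a b x \<oplus> corner a b y"
  by (simp add: corner_def l_distr r_distr)

lemma corner_minus: "x \<in> carrier R \<Longrightarrow> corner a b (\<ominus> x) = \<ominus> corner a b x"
  by (simp add: corner_def l_minus r_minus)

lemma corner_corner:
  assumes "x \<in> carrier R"
  shows "corner a b (corner c d x) = (if a = c \<and> b = d then corner a b x else \<zero>)"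
proof -
  have "corner a b (corner c d x) = (idem a \<otimes> idem c) \<otimes> x \<otimes> (idem d \<otimes> idem b)"
    using assms by (simp add: corner_def m_assoc)
  then show ?thesis
    using assms by (auto simp: idem_mult corner_def)
qed

lemma corner_mult:
  assumes "x \<in> carrier R" "y \<in> carrier R"
  shows "corner a b (x \<otimes> y)
    = corner a True x \<otimes> corner True b y \<oplus> corner a False x \<otimes> corner False b y"
proof -
  have "corner a c x \<otimes> corner c b y = idem a \<otimes> x \<otimes> idem c \<otimes> (y \<otimes> idem b)" for c
  proof -
    have "corner a c x \<otimes> corner c b y = idem a \<otimes> x \<otimes> (idem c \<otimes> idem c) \<otimes> (y \<otimes> idem b)"
      using assms by (simp add: corner_def m_assoc)
    then show ?thesis by (simp add: idem_mult)
  qed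
  moreover have "corner a b (x \<otimes> y) = idem a \<otimes> x \<otimes> (idem True \<oplus> idem False) \<otimes> (y \<otimes> idem b)"
    using assms by (simp add: corner_def m_assoc idem_sum)
  ultimately show ?thesis
    using assms by (simp add: r_distr l_distr)
qed

lemma sum_corners:
  assumes "x \<in> carrier R"
  shows "(corner True True x \<oplus> corner True False x) \<oplus> (corner False True x \<oplus> corner False False x) = x"
proof -
  have "corner a True x \<oplus> corner a False x = idem a \<otimes> x" for a
    using assms r_distr[of "idem True" "idem False" "idem a \<otimes> x"] by (simp add: corner_def idem_sum)
  then show ?thesis
    using assms l_distr[of "idem True" "idem False" x] by (simp add: idem_sum)
qed

lemma eq_if_corners_eq:
  assumes "x \<in> carrier R" "y \<in> carrier R" "\<And>a b. corner a b x = corner a b y"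
  shows "x = y"
  by (subst sum_corners[OF assms(1), symmetric], subst sum_corners[OF assms(2), symmetric])
    (simp only: assms(3))

lemma corner_finsum:
  assumes "finite I" "\<And>i. i \<in> I \<Longrightarrow> f i \<in> carrier R"
  shows "corner a b (\<Oplus>i\<in>I. f i) = (\<Oplus>i\<in>I. corner a b (f i))"
  using assms
proof (induction I rule: finite_induct)
  case (insert i I)
  then show ?case by (simp add: corner_add Pi_def finsum_closed)
qed simp

text \<open>The degree of the Peirce component with indices \<open>a\<close> and \<open>b\<close>.  Different Peirce components can
  share a degree, for instance when \<open>g\<close> has order 2.\<close>

definition degree :: "('g, 'm) monoid_scheme \<Rightarrow> 'g \<Rightarrow> bool \<Rightarrow> bool \<Rightarrow> 'g"
  where "degree G g a b = (if a = b then \<one>\<^bsub>G\<^esub> else if a then g else inv\<^bsub>G\<^esub> g)"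

text \<open>The homogeneous component of degree \<open>h\<close>: the sum of the Peirce components of this degree.\<close>

definition component :: "('g, 'm) monoid_scheme \<Rightarrow> 'g \<Rightarrow> 'g \<Rightarrow> 'a set"
  where "component G g h = {x \<in> carrier R. \<forall>a b. degree G g a b \<noteq> h \<longrightarrow> corner a b x = \<zero>}"

lemma degree_mult:
  assumes "group G" "g \<in> carrier G"
  shows "degree G g a b \<otimes>\<^bsub>G\<^esub> degree G g b c = degree G g a c"
proof -
  interpret G: group G by fact
  show ?thesis using assms(2) by (auto simp: degree_def)
qed

lemma component_sub: "x \<in> component G g h \<Longrightarrow> x \<in> carrier R"
  by (simp add: component_def)

lemma component_corner: "x \<in> component G g h \<Longrightarrow> degree G g a b \<noteq> h \<Longrightarrow> corner a b x = \<zero>"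
  by (simp add: component_def)

lemma additive_subgroup_component: "additive_subgroup (component G g h) R"
proof (rule additive_subgroup.intro)
  show "subgroup (component G g h) (add_monoid R)"
    by (rule add.subgroupI)
      (auto simp: component_def corner_add corner_minus a_inv_def[symmetric] intro!: exI[of _ \<zero>])
qed

lemma peirce_grading:
  assumes G: "group G" and g: "g \<in> carrier G"
  shows "graded_ring G R (component G g)"
proof -
  interpret G: group G by fact
  note sub = component_sub[of _ G g]
  have degree_closed: "degree G g a b \<in> carrier G" for a b
    using g by (simp add: degree_def)
  show ?thesis
  proof (intro graded_ring.intro graded_ring_axioms.intro G.group_axioms ring_axioms
      additive_subgroup_component)
    fix h k x y
    assume x: "x \<in> component G g h" and y: "y \<in> component G g k"
    have "corner a b (x \<otimes> y) = \<zero>" if "degree G g a b \<noteq> h \<otimes>\<^bsub>G\<^esub> k" for a b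
    proof -
      have "corner a c x \<otimes> corner c b y = \<zero>" for c
      proof -
        have "degree G g a c \<noteq> h \<or> degree G g c b \<noteq> k"
          using that degree_mult[OF G g, of a c b] by auto
        then show ?thesis
          using component_corner[OF x] component_corner[OF y] sub[OF x] sub[OF y] by auto
      qed
      then show ?thesis using corner_mult[OF sub[OF x] sub[OF y]] by simp
    qed
    then show "x \<otimes> y \<in> component G g (h \<otimes>\<^bsub>G\<^esub> k)"
      using sub[OF x] sub[OF y] by (simp add: component_def)
  next
    fix x assume x: "x \<in> carrier R"
    define supp where "supp c = {h \<in> carrier G. c h \<noteq> \<zero>}" for c :: "_ \<Rightarrow> 'a"
    define pick where "pick h a b = (if degree G g a b = h then corner a b x else \<zero>)" for h a b
    define proj where
      "proj h = (pick h True True \<oplus> pick h True False) \<oplus> (pick h False True \<oplus> pick h False False)" for h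
    have pick_closed [simp]: "pick h a b \<in> carrier R" for h a b
      using x by (simp add: pick_def)
    have proj_closed: "proj h \<in> carrier R" for h
      by (simp add: proj_def)
    have corner_proj: "corner a b (proj h) = (if degree G g a b = h then corner a b x else \<zero>)" for a b h
    proof -
      have "corner a b (pick h c d) = (if a = c \<and> b = d then pick h a b else \<zero>)" for c d
        using x by (auto simp: pick_def corner_corner)
      then have "corner a b (proj h) = pick h a b"
        by (cases a; cases b) (simp_all add: proj_def corner_add)
      then show ?thesis by (simp add: pick_def)
    qed
    \<comment> \<open>A corner of a sum of homogeneous elements only sees the summand in the degree of this corner.\<close>
    have corner_sum: "corner a b (\<Oplus>h\<in>supp c. c h) = corner a b (c (degree G g a b))"
      if c: "\<And>h. h \<in> carrier G \<Longrightarrow> c h \<in> component G g h" and fin: "finite (supp c)" for c a b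
    proof -
      let ?d = "degree G g a b"
      have cc: "c h \<in> carrier R" if "h \<in> carrier G" for h using sub[OF c[OF that]] .
      have "corner a b (\<Oplus>h\<in>supp c. c h) = (\<Oplus>h\<in>supp c. corner a b (c h))"
        using fin cc by (intro corner_finsum) (auto simp: supp_def)
      also have "\<dots> = (\<Oplus>h\<in>supp c. if ?d = h then corner a b (c h) else \<zero>)"
        using component_corner[OF c] cc by (intro finsum_cong') (auto simp: supp_def)
      also have "\<dots> = corner a b (c ?d)"
      proof (cases "?d \<in> supp c")
        case True
        then show ?thesis
          using fin cc by (intro finsum_singleton) (auto simp: supp_def)
      next
        case False
        then have "c ?d = \<zero>" using degree_closed by (simp add: supp_def)
        moreover have "(\<Oplus>h\<in>supp c. if ?d = h then corner a b (c h) else \<zero>) = (\<Oplus>h\<in>supp c. \<zero>)"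
          using False by (intro finsum_cong') auto
        ultimately show ?thesis by simp
      qed
      finally show ?thesis .
    qed
    have unique: "c h = proj h"
      if "\<And>h. h \<in> carrier G \<Longrightarrow> c h \<in> component G g h" "finite (supp c)" "x = (\<Oplus>h\<in>supp c. c h)"
        "h \<in> carrier G" for c h
    proof (rule eq_if_corners_eq[OF sub[OF that(1)[OF that(4)]] proj_closed])
      fix a b
      show "corner a b (c h) = corner a b (proj h)"
        using corner_sum[OF that(1,2), of a b] component_corner[OF that(1)[OF that(4)], of a b] that(3)
        by (auto simp: corner_proj)
    qed
    define c where "c = (\<lambda>h\<in>carrier G. proj h)"
    have c: "c h \<in> component G g h" if "h \<in> carrier G" for h
      using that proj_closed by (simp add: c_def component_def corner_proj)
    have fin: "finite (supp c)"
    proof (rule finite_subset)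
      show "supp c \<subseteq> {\<one>\<^bsub>G\<^esub>, g, inv\<^bsub>G\<^esub> g}"
      proof
        fix h assume "h \<in> supp c"
        then have h: "h \<in> carrier G" "proj h \<noteq> \<zero>" by (auto simp: supp_def c_def)
        have "\<exists>a b. degree G g a b = h"
        proof (rule ccontr)
          assume "\<not> ?thesis"
          then have "pick h a b = \<zero>" for a b by (auto simp: pick_def)
          then show False using h(2) by (simp add: proj_def)
        qed
        then show "h \<in> {\<one>\<^bsub>G\<^esub>, g, inv\<^bsub>G\<^esub> g}"
          by (auto simp: degree_def split: if_splits)
      qed
    qed simp
    have "x = (\<Oplus>h\<in>supp c. c h)"
    proof (rule eq_if_corners_eq[OF x])
      show "(\<Oplus>h\<in>supp c. c h) \<in> carrier R"
        using sub[OF c] by (intro finsum_closed) (auto simp: supp_def)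
      show "corner a b x = corner a b (\<Oplus>h\<in>supp c. c h)" for a b
      proof -
        have "c (degree G g a b) = proj (degree G g a b)"
          using degree_closed by (simp add: c_def)
        moreover have "corner a b (\<Oplus>h\<in>supp c. c h) = corner a b (c (degree G g a b))"
          using c fin by (rule corner_sum)
        ultimately show ?thesis by (simp add: corner_proj)
      qed
    qed
    with c fin have "c \<in> (\<Pi>\<^sub>E h\<in>carrier G. component G g h) \<and> finite (supp c) \<and> x = (\<Oplus>h\<in>supp c. c h)"
      by (auto simp: c_def)
    moreover have "c' = c"
      if "c' \<in> (\<Pi>\<^sub>E h\<in>carrier G. component G g h) \<and> finite (supp c') \<and> x = (\<Oplus>h\<in>supp c'. c' h)" for c'
    proof (rule extensionalityI[of _ "carrier G"])
      show "c' h = c h" if "h \<in> carrier G" for h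
        using that \<open>c' \<in> _ \<and> _\<close> unique[of c' h] by (auto simp: c_def PiE_def Pi_def)
    qed (use that in \<open>auto simp: c_def PiE_def\<close>)
    ultimately show "\<exists>!c. c \<in> (\<Pi>\<^sub>E h\<in>carrier G. component G g h) \<and>
        finite {h \<in> carrier G. c h \<noteq> \<zero>} \<and> x = (\<Oplus>h\<in>{h \<in> carrier G. c h \<noteq> \<zero>}. c h)"
      unfolding supp_def by blast
  qed
qed

lemma component_one:
  assumes "group G" "g \<in> carrier G" "g \<noteq> \<one>\<^bsub>G\<^esub>"
  shows "component G g \<one>\<^bsub>G\<^esub> = {x \<in> carrier R. corner True False x = \<zero> \<and> corner False True x = \<zero>}"
proof -
  interpret G: group G by fact
  have "inv\<^bsub>G\<^esub> g \<noteq> \<one>\<^bsub>G\<^esub>" using assms by (simp add: G.inv_eq_1_iff)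
  then show ?thesis
    using assms(3) by (auto simp: component_def degree_def)
qed

text \<open>By \<open>component_one\<close>, this is the base ring.\<close>

lemma subring_diagonal: "subring {x \<in> carrier R. corner True False x = \<zero> \<and> corner False True x = \<zero>} R"
proof (rule subringI)
  have "corner a b \<one> = (if a = b then idem a else \<zero>)" for a b
    by (simp add: corner_def idem_mult)
  then show "\<one> \<in> {x \<in> carrier R. corner True False x = \<zero> \<and> corner False True x = \<zero>}"
    by simp
qed (auto simp: corner_add corner_minus corner_mult)

end

section \<open>The ring on the natural numbers\<close>

instance gen :: countable
  by countable_datatype

lemma inj_to_nat: "\<exists>f :: (gen list \<Rightarrow>\<^sub>0 bit) \<Rightarrow> nat. inj f"
proof -
  define f where "f v = to_nat (SOME xs. set xs = keys v)" for v :: "gen list \<Rightarrow>\<^sub>0 bit"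
  have "inj f"
  proof (rule injI)
    fix u v assume eq: "f u = f v"
    have set_some: "set (SOME xs. set xs = keys v) = keys v" for v :: "gen list \<Rightarrow>\<^sub>0 bit"
      by (rule someI_ex) (rule finite_list, simp)
    from eq have "(SOME xs. set xs = keys u) = (SOME xs. set xs = keys v)"
      by (simp add: f_def)
    then have "keys u = keys v" using set_some by metis
    then have "(\<Sum>w\<in>keys u. basis w) = (\<Sum>w\<in>keys v. basis w)" by simp
    then show "u = v" by (simp only: sum_basis_keys)
  qed
  then show ?thesis by blast
qed

text \<open>The ring is transported to the natural numbers along an arbitrary injection.\<close>

definition enc :: "(gen list \<Rightarrow>\<^sub>0 bit) \<Rightarrow> nat"
  where "enc = (SOME f. inj f)"

definition dec :: "nat \<Rightarrow> gen list \<Rightarrow>\<^sub>0 bit"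
  where "dec = the_inv enc"

lemma dec_enc [simp]: "dec (enc v) = v"
proof -
  have "inj enc" unfolding enc_def by (rule someI_ex[OF inj_to_nat])
  then show ?thesis by (simp add: dec_def the_inv_f_f)
qed

text \<open>The ring \<open>R\<close>, with the elements supported on normal words.\<close>

definition nat_ring :: "nat \<Rightarrow> nat ring"
  where "nat_ring n =
    \<lparr>carrier = enc ` {v. supported normal v},
     monoid.mult = (\<lambda>x y. enc (mul n True (dec x) (dec y))), one = enc (basis []),
     ring.zero = enc 0, add = (\<lambda>x y. enc (dec x + dec y))\<rparr>"

lemma nat_ring_simps:
  "x \<otimes>\<^bsub>nat_ring n\<^esub> y = enc (mul n True (dec x) (dec y))"
  "\<one>\<^bsub>nat_ring n\<^esub> = enc (basis [])"
  "\<zero>\<^bsub>nat_ring n\<^esub> = enc 0"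
  "x \<oplus>\<^bsub>nat_ring n\<^esub> y = enc (dec x + dec y)"
  by (simp_all add: nat_ring_def)

lemma nat_ring_carrierI: "supported normal v \<Longrightarrow> enc v \<in> carrier (nat_ring n)"
  by (simp add: nat_ring_def)

lemma supported_dec: "x \<in> carrier (nat_ring n) \<Longrightarrow> supported normal (dec x)"
  by (auto simp: nat_ring_def)

lemma enc_dec: "x \<in> carrier (nat_ring n) \<Longrightarrow> enc (dec x) = x"
  by (auto simp: nat_ring_def)

lemma ring_nat_ring: "ring (nat_ring n)"
proof (rule ringI)
  show "abelian_group (nat_ring n)"
  proof (rule abelian_groupI)
    fix x assume x: "x \<in> carrier (nat_ring n)"
    then show "\<exists>y\<in>carrier (nat_ring n). y \<oplus>\<^bsub>nat_ring n\<^esub> x = \<zero>\<^bsub>nat_ring n\<^esub>"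
      by (intro bexI[of _ x]) (simp_all add: nat_ring_simps)
  qed (auto simp: nat_ring_simps add_ac enc_dec intro!: nat_ring_carrierI supported_add dest: supported_dec)
  show "monoid (nat_ring n)"
    by (rule monoidI)
      (auto simp: nat_ring_simps mul_assoc enc_dec mul_one_left supported_dec
        intro!: nat_ring_carrierI supported_normal_mul dest: supported_dec)
qed (simp_all add: nat_ring_simps mul_add_left mul_add_right)

section \<open>The base ring\<close>

lemma word_act_append_Ge:
  "normal (s @ [Ge]) \<Longrightarrow> word_act n True (s @ [Ge]) (basis (Ge # p)) = basis (s @ Ge # p)"
proof (induction s)
  case (Cons x s)
  have "reducible x (s @ Ge # p) \<longleftrightarrow> reducible x (s @ [Ge])"
  proof (cases s)
    case Nil
    then show ?thesis by (cases x) simp_all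
  next
    case (Cons a s')
    then show ?thesis by (cases x; cases a) simp_all
  qed
  with Cons show ?case by (simp add: act_irreducible)
qed simp

text \<open>The augmentation of the corner \<open>e R e\<close> is multiplicative.  As words are reversed, those of the
  form \<open>Ge # p\<close> end in \<open>e\<close> and those of the form \<open>s @ [Ge]\<close> begin with \<open>e\<close>.\<close>

lemma lookup_mul_corner:
  assumes "supported (\<lambda>w. \<exists>p. w = Ge # p) u" "supported (\<lambda>w. normal w \<and> (\<exists>s. w = s @ [Ge])) v"
  shows "lookup (mul n True u v) [Ge] = lookup u [Ge] * lookup v [Ge]"
proof (rule additive_eqI[where v = v])
  fix w assume "w \<in> keys v"
  then obtain s where w: "normal w" "w = s @ [Ge]"
    using assms(2) by (auto simp: supported_def)
  show "lookup (mul n True u (basis w)) [Ge] = lookup u [Ge] * lookup (basis w) [Ge]"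
  proof (rule additive_eqI[where v = u])
    fix w' assume "w' \<in> keys u"
    then obtain p where "w' = Ge # p"
      using assms(1) by (auto simp: supported_def)
    moreover have "s @ Ge # p = [Ge] \<longleftrightarrow> p = [] \<and> s = []"
      by (cases s) auto
    ultimately show "lookup (mul n True (basis w') (basis w)) [Ge]
        = lookup (basis w') [Ge] * lookup (basis w) [Ge]"
      using w word_act_append_Ge[of s n p] by (auto simp: lookup_single when_def)
  next
    show "Modules.additive (\<lambda>u. lookup u [Ge] * lookup (basis w) [Ge])"
      by standard (simp only: lookup_add distrib_right)
  qed (rule additive_compose[OF additive_lookup additive_mul_left])
next
  show "Modules.additive (\<lambda>v. lookup u [Ge] * lookup v [Ge])"
    by standard (simp only: lookup_add distrib_left)
qed (rule additive_compose[OF additive_lookup additive_mul_right])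

lemma supported_Ge_left:
  assumes "supported normal v"
  shows "supported (\<lambda>w. normal w \<and> (\<exists>s. w = s @ [Ge])) (mul n True (basis [Ge]) v)"
proof (rule supported_conj)
  show "supported normal (mul n True (basis [Ge]) v)"
    using assms by (intro supported_normal_mul) simp_all
  show "supported (\<lambda>w. \<exists>s. w = s @ [Ge]) (mul n True (basis [Ge]) v)"
  proof (rule supported_mul[where P = "\<lambda>w. w = [Ge]" and Q = "\<lambda>_. True"])
    show "supported (\<lambda>w. \<exists>s. w = s @ [Ge]) (act n True x w)" if w: "\<exists>s. w = s @ [Ge]" for x w
    proof (cases "reducible x w")
      case False
      then show ?thesis using w by (auto simp: act_irreducible)
    next
      case True
      then show ?thesis
      proof (cases rule: reducibleE)
        case (1 k i t)
        then obtain s where "t = s @ [Ge]"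
          using w by (auto simp: Cons_eq_append_conv)
        then show ?thesis using 1 by (auto intro!: supported_add supported_sum)
      next
        case (2 t)
        then show ?thesis using w by simp
      qed
    qed
  qed (auto simp: supported_def)
qed

lemma supported_Ge_right: "supported (\<lambda>w. \<exists>p. w = Ge # p) (mul n True u (basis [Ge]))"
proof -
  have "supported (\<lambda>w. \<exists>p. w = Ge # p) (act n True Ge w)" for w
    by (cases "reducible Ge w") (auto simp: act_irreducible elim: reducibleE)
  then show ?thesis
    unfolding mul_basis_right word_act.simps
    by (intro supported_lin[where Q = "\<lambda>_. True"]) (simp_all add: supported_def[of "\<lambda>_. True"])
qed

lemma peirce_nat_ring: "peirce (nat_ring n) (enc (basis [Ge]))"
  by (intro peirce.intro peirce_axioms.intro ring_nat_ring nat_ring_carrierI)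
    (simp_all add: nat_ring_simps)

lemma base_ring_has_UGN:
  assumes "group G" "g \<in> carrier G" "g \<noteq> \<one>\<^bsub>G\<^esub>"
  shows "has_UGN (base_ring G (nat_ring n) (peirce.component (nat_ring n) (enc (basis [Ge])) G g))"
proof -
  interpret peirce "nat_ring n" "enc (basis [Ge])" by (rule peirce_nat_ring)
  let ?R = "nat_ring n"
  let ?S = "base_ring G ?R (component G g)"
  have S_carrier: "carrier ?S = {x \<in> carrier ?R. corner True False x = \<zero>\<^bsub>?R\<^esub> \<and> corner False True x = \<zero>\<^bsub>?R\<^esub>}"
    by (simp add: base_ring_def component_one[OF assms])
  have S_ops: "x \<oplus>\<^bsub>?S\<^esub> y = x \<oplus>\<^bsub>?R\<^esub> y" "x \<otimes>\<^bsub>?S\<^esub> y = x \<otimes>\<^bsub>?R\<^esub> y" "\<one>\<^bsub>?S\<^esub> = \<one>\<^bsub>?R\<^esub>" for x y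
    by (simp_all add: base_ring_def)
  have dec_corner: "dec (corner True True x) = mul n True (mul n True (basis [Ge]) (dec x)) (basis [Ge])" for x
    by (simp add: corner_def idem_def nat_ring_simps)
  let ?\<psi> = "\<lambda>x. lookup (dec (corner True True x)) [Ge]"
  show ?thesis
  proof (rule has_UGN_if_F2_character[where \<psi> = ?\<psi>])
    show "ring ?S"
      using subring_is_ring[OF subring_diagonal] by (simp add: base_ring_def component_one[OF assms])
    show "?\<psi> (x \<oplus>\<^bsub>?S\<^esub> y) = ?\<psi> x + ?\<psi> y" if "x \<in> carrier ?S" "y \<in> carrier ?S" for x y
    proof -
      have "corner True True (x \<oplus>\<^bsub>?R\<^esub> y) = corner True True x \<oplus>\<^bsub>?R\<^esub> corner True True y"
        using that unfolding S_carrier by (intro corner_add) auto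
      then show ?thesis
        unfolding S_ops by (simp only: nat_ring_simps(4) dec_enc lookup_add)
    qed
    show "?\<psi> (x \<otimes>\<^bsub>?S\<^esub> y) = ?\<psi> x * ?\<psi> y" if "x \<in> carrier ?S" "y \<in> carrier ?S" for x y
    proof -
      have x: "x \<in> carrier ?R" "corner True False x = \<zero>\<^bsub>?R\<^esub>" and y: "y \<in> carrier ?R"
        using that by (simp_all add: S_carrier)
      have "corner True True (x \<otimes>\<^bsub>?R\<^esub> y) = corner True True x \<otimes>\<^bsub>?R\<^esub> corner True True y"
        using x y by (simp add: corner_mult)
      then have "dec (corner True True (x \<otimes>\<^bsub>?R\<^esub> y)) = mul n True (dec (corner True True x)) (dec (corner True True y))"
        by (simp add: nat_ring_simps)
      moreover have "supported (\<lambda>w. \<exists>p. w = Ge # p) (dec (corner True True x))"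
        unfolding dec_corner by (rule supported_Ge_right)
      moreover have "supported (\<lambda>w. normal w \<and> (\<exists>s. w = s @ [Ge])) (dec (corner True True y))"
        unfolding dec_corner mul_assoc
        by (intro supported_Ge_left supported_normal_mul supported_dec[OF y]) simp
      ultimately show ?thesis
        unfolding S_ops by (simp only: lookup_mul_corner)
    qed
    show "?\<psi> \<one>\<^bsub>?S\<^esub> = 1"
      unfolding S_ops dec_corner by (simp add: nat_ring_simps)
  qed
qed

section \<open>The generating number\<close>

text \<open>The homomorphism onto the subring without \<open>e\<close> that sends \<open>e\<close> to 0.\<close>

definition kill :: "(gen list \<Rightarrow>\<^sub>0 bit) \<Rightarrow> gen list \<Rightarrow>\<^sub>0 bit"
  where "kill = part (\<lambda>w. Ge \<notin> set w)"

lemma additive_kill: "Modules.additive kill"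
  unfolding kill_def by (rule additive_part)

lemma kill_act: "kill (lin (act n q x) v) = (if x = Ge then 0 else lin (act n q x) (kill v))"
    (is "?F v = ?G v")
proof (rule additive_eqI[where F = ?F and G = ?G])
  show "Modules.additive ?G"
    by (rule additive_if[OF additive_zero additive_compose[OF additive_lin additive_kill]])
  show "?F (basis w) = ?G (basis w)" for w
  proof (cases "reducible x w")
    case False
    then show ?thesis by (auto simp: act_irreducible kill_def)
  next
    case True
    then show ?thesis
      by (elim reducibleE) (auto simp: kill_def additive.add[OF additive_part] part_sum)
  qed
qed (rule additive_compose[OF additive_kill additive_lin])

lemma kill_mul: "kill (mul n q u v) = mul n q (kill u) (kill v)"
    (is "?F v = ?G v")
proof (rule additive_eqI[where F = ?F and G = ?G])
  have "kill (word_act n q w u) = (if Ge \<in> set w then 0 else word_act n q w (kill u))" for w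
    by (induction w) (auto simp: kill_act)
  then show "?F (basis w) = ?G (basis w)" for w
    by (auto simp: kill_def)
qed (rule additive_compose[OF additive_kill additive_mul_right]
    additive_compose[OF additive_mul_right additive_kill])+

lemma no_epi_below:
  assumes "m < n"
  shows "f \<notin> rmodule_epi (nat_ring n) (free_rmodule (nat_ring n) m) (free_rmodule (nat_ring n) (m + 1))"
proof
  let ?R = "nat_ring n"
  let ?\<psi> = "\<lambda>x. kill (dec x)"
  assume f: "f \<in> rmodule_epi ?R (free_rmodule ?R m) (free_rmodule ?R (m + 1))"
  have add: "?\<psi> (x \<oplus>\<^bsub>?R\<^esub> y) = ?\<psi> x + ?\<psi> y" for x y
    by (simp add: nat_ring_simps additive.add[OF additive_kill])
  have mult: "?\<psi> (x \<otimes>\<^bsub>?R\<^esub> y) = mul n True (?\<psi> x) (?\<psi> y)" for x y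
    by (simp add: nat_ring_simps kill_mul)
  have one: "?\<psi> \<one>\<^bsub>?R\<^esub> = basis []"
    by (simp add: nat_ring_simps kill_def)
  have good_kill: "supported good (?\<psi> x)" if "x \<in> carrier ?R" for x
    unfolding kill_def by (rule supported_mono[OF supported_part[OF supported_dec[OF that]]]) (simp add: good_def)
  obtain C D where C: "\<And>i j. i < m + 1 \<Longrightarrow> j < m \<Longrightarrow> C i j \<in> carrier ?R"
    and D: "\<And>j k. j < m \<Longrightarrow> k < m + 1 \<Longrightarrow> D j k \<in> carrier ?R"
    and CD: "\<And>i k. i < m + 1 \<Longrightarrow> k < m + 1 \<Longrightarrow>
      (\<Sum>j<m. mul n True (?\<psi> (C i j)) (?\<psi> (D j k))) = (if i = k then ?\<psi> \<one>\<^bsub>?R\<^esub> else 0)"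
    by (rule epi_matrices[OF ring_nat_ring f, where \<psi> = ?\<psi> and M = "mul n True", OF add mult]) blast+
  show False
    by (rule no_right_inverse_mul[OF assms, of "\<lambda>i j. ?\<psi> (C i j)" "\<lambda>j k. ?\<psi> (D j k)"])
      (use C D CD one good_kill in auto)
qed

lemma generic_matrices:
  assumes "n > 0"
  shows "(\<Sum>j<n. mul n True (basis [Ga i j]) (basis [Gb j k])) = (if i = k then basis [] else 0)"
proof -
  let ?m = "\<lambda>j. mul n True (basis [Ga i j]) (basis [Gb j k])"
  have "{..<n} = insert 0 {1..<n}" using assms by auto
  then have "(\<Sum>j<n. ?m j) = ?m 0 + (\<Sum>j\<in>{1..<n}. ?m j)" by simp
  also have "(\<Sum>j\<in>{1..<n}. ?m j) = (\<Sum>j\<in>{1..<n}. basis [Gb j k, Ga i j])"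
    by (intro sum.cong) auto
  finally show ?thesis by (simp add: add.assoc)
qed

lemma epi_at:
  assumes "n > 0"
  shows "\<exists>f. f \<in> rmodule_epi (nat_ring n) (free_rmodule (nat_ring n) n) (free_rmodule (nat_ring n) (n + 1))"
proof -
  let ?R = "nat_ring n"
  define f where "f x = (\<lambda>i\<in>{..<n + 1}. enc (\<Sum>j<n. mul n True (basis [Ga i j]) (dec (x j))))" for x :: "nat \<Rightarrow> nat"
  define h where "h y = (\<lambda>j\<in>{..<n}. enc (\<Sum>k<n + 1. mul n True (basis [Gb j k]) (dec (y k))))" for y :: "nat \<Rightarrow> nat"
  have mem: "x \<in> carrier (free_rmodule ?R r) \<longleftrightarrow> (\<forall>i<r. x i \<in> carrier ?R) \<and> x \<in> extensional {..<r}" for x r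
    by (auto simp: free_rmodule_def PiE_def Pi_def)
  have f_closed: "f x \<in> carrier (free_rmodule ?R (n + 1))" if "x \<in> carrier (free_rmodule ?R n)" for x
    using that
    by (auto simp: mem f_def intro!: nat_ring_carrierI supported_sum supported_normal_mul dest: supported_dec)
  have h_closed: "h y \<in> carrier (free_rmodule ?R n)" if "y \<in> carrier (free_rmodule ?R (n + 1))" for y
    using that
    by (auto simp: mem h_def simp del: sum.lessThan_Suc intro!: nat_ring_carrierI supported_sum supported_normal_mul dest: supported_dec)
  have fh: "f (h y) = y" if y: "y \<in> carrier (free_rmodule ?R (n + 1))" for y
  proof (rule extensionalityI[of _ "{..<n + 1}"])
    fix i assume i: "i \<in> {..<n + 1}"
    have "(\<Sum>j<n. mul n True (basis [Ga i j]) (dec (h y j)))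
        = (\<Sum>j<n. \<Sum>k<n + 1. mul n True (mul n True (basis [Ga i j]) (basis [Gb j k])) (dec (y k)))"
      by (intro sum.cong refl) (simp only: h_def restrict_apply' dec_enc mul_sum_right mul_assoc)
    also have "\<dots> = (\<Sum>k<n + 1. mul n True (\<Sum>j<n. mul n True (basis [Ga i j]) (basis [Gb j k])) (dec (y k)))"
      unfolding mul_sum_left by (rule sum.swap)
    also have "\<dots> = (\<Sum>k<n + 1. if i = k then dec (y k) else 0)"
    proof (intro sum.cong refl)
      fix k assume "k \<in> {..<n + 1}"
      then have "supported normal (dec (y k))"
        using y by (auto simp: mem dest: supported_dec)
      then show "mul n True (\<Sum>j<n. mul n True (basis [Ga i j]) (basis [Gb j k])) (dec (y k))
          = (if i = k then dec (y k) else 0)"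
        unfolding generic_matrices[OF assms] by (simp add: mul_one_left)
    qed
    also have "\<dots> = dec (y i)"
      using i by (simp add: sum.delta)
    finally show "f (h y) i = y i"
      using i y enc_dec[of "y i" n] by (simp add: f_def mem)
  qed (use y in \<open>auto simp: f_def mem\<close>)
  have "f \<in> rmodule_hom ?R (free_rmodule ?R n) (free_rmodule ?R (n + 1))"
    unfolding rmodule_hom_def
  proof (intro CollectI conjI ballI funcsetI f_closed)
    fix x y assume "x \<in> carrier (free_rmodule ?R n)" "y \<in> carrier (free_rmodule ?R n)"
    show "f (x \<oplus>\<^bsub>free_rmodule ?R n\<^esub> y) = f x \<oplus>\<^bsub>free_rmodule ?R (n + 1)\<^esub> f y"
      by (simp add: f_def free_rmodule_def nat_ring_simps fun_eq_iff restrict_def mul_add_right sum.distrib)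
  next
    fix x r
    show "f (x \<triangleleft>\<^bsub>free_rmodule ?R n\<^esub> r) = f x \<triangleleft>\<^bsub>free_rmodule ?R (n + 1)\<^esub> r"
      by (simp add: f_def free_rmodule_def nat_ring_simps fun_eq_iff restrict_def mul_assoc mul_sum_left)
  qed
  moreover have "f ` carrier (free_rmodule ?R n) = carrier (free_rmodule ?R (n + 1))"
    using f_closed h_closed fh by (auto intro!: image_eqI[of _ f])
  ultimately show ?thesis unfolding rmodule_epi_def by blast
qed

lemma gn_nat_ring:
  assumes "n > 0"
  shows "gn (nat_ring n) = enat n"
proof -
  have "(LEAST p. p > 0 \<and> (\<exists>f. f \<in> rmodule_epi (nat_ring n) (free_rmodule (nat_ring n) p)
      (free_rmodule (nat_ring n) (p + 1)))) = n"
    using assms epi_at no_epi_below by (intro Least_equality) (auto simp: not_less[symmetric])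
  moreover have "\<not> has_UGN (nat_ring n)"
    unfolding has_UGN_def using assms epi_at[OF assms] by blast
  ultimately show ?thesis by (simp add: gn_def)
qed

theorem theorem4p10:
  fixes G :: "('g, 'm) monoid_scheme" and n :: nat
  assumes "group G" and "finite (carrier G)" and "carrier G \<noteq> {\<one>\<^bsub>G\<^esub>}"
    and "n > 0"
  shows "\<exists>(R :: nat ring) (A :: 'g \<Rightarrow> nat set).
    graded_ring G R A \<and> has_UGN (base_ring G R A) \<and> gn R = enat n"
proof -
  interpret group G by fact
  obtain g where g: "g \<in> carrier G" "g \<noteq> \<one>\<^bsub>G\<^esub>"
    using assms(3) one_closed by blast
  let ?A = "peirce.component (nat_ring n) (enc (basis [Ge])) G g"
  have "graded_ring G (nat_ring n) ?A"
    by (rule peirce.peirce_grading[OF peirce_nat_ring assms(1) g(1)])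
  moreover have "has_UGN (base_ring G (nat_ring n) ?A)"
    by (rule base_ring_has_UGN[OF assms(1) g])
  ultimately show ?thesis using gn_nat_ring[OF assms(4)] by blast
qed

end
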